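(* If $d,b_0,\dots,b_n$ is a modular sequence in a harmonic matroid $M$, then it is a Möbius harmonic net.
   Context: Matroids may have an infinite ground set; $\operatorname{cl}$ denotes closure. Matroids are taken to be simple, so that "point" means element (for lattice-type examples, a rank-one flat); a set of points is collinear if it has rank at most $2$. For elements $y,x,z,o,q,r,s$ of a matroid $M$, $\mathrm{HP}(y,x,z;o,q,r,s)$ means that these are seven distinct elements and the restriction $M|\{y,x,z,o,q,r,s\}$ is a rank-3 matroid whose three-point lines are $\{y,x,z\},\{y,o,q\},\{y,r,s\},\{x,q,s\},\{z,o,s\},\{z,q,r\}$ and possibly also $\{x,o,r\}$, and no other set of three elements is collinear (so it is the non-Fano matroid $F_7^-$, or the Fano matroid $F_7$ if $\{x,o,r\}$ is collinear). For elements $y,x,z$ of $M$, a point $x'$ is a harmonic conjugate of $x$ with respect to $y$ and $z$, written $\mathrm{H}(y,z;x,x')$, if there are elements $o,q,r,s$ with $\mathrm{HP}(y,x,z;o,q,r,s)$ and $\operatorname{cl}(\{y,z\})\cap\operatorname{cl}(\{o,r\})=\{x'\}$. A harmonic matroid is a matroid such that every $\{y,x,z,o,q,r,s\}$ with $\mathrm{HP}(y,x,z;o,q,r,s)$ gives rise to such a harmonic conjugate $x'$, and $x'$ depends only on $x,y,z$ and not on the choice of $o,q,r,s$. For a subset $S$ of the ground set of a harmonic matroid $M$: $h(S)=S\cup\{x\in M: \mathrm{H}(a,c;b,x)\text{ for some }a,b,c\in S\}$, $h^n(S)=h(h^{n-1}(S))$ with $h^0(S)=S$, and $h^\infty(S)=\bigcup_{n\ge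 0}h^n(S)$. A conjugate sequence is a sequence of points $A,a_0,a_1,\dots,a_m,\dots$ in a harmonic matroid with $\mathrm{H}(A,a_i;a_{i-1},a_{i+1})$ for all $i\ge 1$. It is modular if at least one of its points is equal to one of the preceding points. A modular sequence in which $a_m$ is the first point that is equal to one of its preceding points is denoted $A,a_0,a_1,\dots,a_{m-1}$. (So here $A=d$, $a_i=b_i$, and $b_{n+1}$ is the first point equal to a preceding one.) A sequence $S$ of collinear points is a Möbius harmonic net if $h^\infty(S)=S$ (with $S$ regarded as the set of its points). *)

theory Defs
  imports Main "HOL-Library.Extended_Nat"
begin

record 'a matroid =
  ground :: "'a set"
  cl :: "'a set \<Rightarrow> 'a set"

definition indep :: "'a matroid \<Rightarrow> 'a set \<Rightarrow> bool" where
  "indep M I \<longleftrightarrow> I \<subseteq> ground M \<and> (\<forall>x\<in>I. x \<notin> cl M (I - {x}))"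

text \<open>The closure axioms for matroids on a possibly infinite ground set due to Bruhn, Diestel,
  Kriesell, Pendavingh and Wollan. Finitary matroids (combinatorial pregeometries) are
  the instances in which, moreover, every element of the closure of a set lies in the closure of a
  finite subset; this is not required here.\<close>

locale matroid =
  fixes M :: "'a matroid"
  assumes cl_subset_ground: "X \<subseteq> ground M \<Longrightarrow> cl M X \<subseteq> ground M"
    and cl_extensive: "X \<subseteq> ground M \<Longrightarrow> X \<subseteq> cl M X"
    and cl_mono: "X \<subseteq> Y \<Longrightarrow> Y \<subseteq> ground M \<Longrightarrow> cl M X \<subseteq> cl M Y"
    and cl_idem: "X \<subseteq> ground M \<Longrightarrow> cl M (cl M X) = cl M X"
    and cl_exchange: "Z \<subseteq> ground M \<Longrightarrow> x \<in> ground M \<Longrightarrow>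
          y \<in> cl M (insert x Z) - cl M Z \<Longrightarrow> x \<in> cl M (insert y Z)"
    and maximal_indep: "indep M I \<Longrightarrow> I \<subseteq> X \<Longrightarrow> X \<subseteq> ground M \<Longrightarrow>
          \<exists>B. indep M B \<and> I \<subseteq> B \<and> B \<subseteq> X \<and> (\<forall>B'. indep M B' \<and> B \<subseteq> B' \<and> B' \<subseteq> X \<longrightarrow> B' = B)"

text \<open>Simple: neither loops nor parallel elements.\<close>

locale simple_matroid = matroid +
  assumes cl_empty: "cl M {} = {}"
    and cl_singleton: "x \<in> ground M \<Longrightarrow> cl M {x} = {x}"

definition restriction :: "'a matroid \<Rightarrow> 'a set \<Rightarrow> 'a matroid" where
  "restriction M X = \<lparr>ground = X, cl = (\<lambda>A. cl M A \<inter> X)\<rparr>"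

text \<open>Taking the supremum over finite independent sets loses nothing, since subsets of independent
  sets are independent: the rank is \<open>\<infinity>\<close> whenever there is an infinite independent set.\<close>

definition mrank :: "'a matroid \<Rightarrow> 'a set \<Rightarrow> enat" where
  "mrank M X = (SUP I\<in>{I. I \<subseteq> X \<and> finite I \<and> indep M I}. enat (card I))"

definition collinear_in :: "'a matroid \<Rightarrow> 'a set \<Rightarrow> bool" where
  "collinear_in M X \<longleftrightarrow> mrank M X \<le> 2"

definition mline :: "'a matroid \<Rightarrow> 'a set \<Rightarrow> bool" where
  "mline M L \<longleftrightarrow> L \<subseteq> ground M \<and> cl M L = L \<and> mrank M L = 2"

text \<open>The seven-point configuration \<open>HP(y,x,z;o,q,r,s)\<close>; the point \<open>o\<close> is
  called \<open>p\<close>, because \<open>o\<close> is infix syntax for function composition.\<close>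

definition HP :: "'a matroid \<Rightarrow> 'a \<Rightarrow> 'a \<Rightarrow> 'a \<Rightarrow> 'a \<Rightarrow> 'a \<Rightarrow> 'a \<Rightarrow> 'a \<Rightarrow> bool" where
  "HP M y x z p q r s \<longleftrightarrow>
     distinct [y, x, z, p, q, r, s] \<and> {y, x, z, p, q, r, s} \<subseteq> ground M \<and>
     (let N = restriction M {y, x, z, p, q, r, s};
          \<L> = {L. mline N L \<and> card L = 3};
          \<T> = {{y, x, z}, {y, p, q}, {y, r, s}, {x, q, s}, {z, p, s}, {z, q, r}}
      in mrank N (ground N) = 3 \<and>
         (\<L> = \<T> \<or> \<L> = insert {x, p, r} \<T>) \<and>
         (\<forall>T. T \<subseteq> ground N \<and> card T = 3 \<and> collinear_in N T \<longrightarrow> T \<in> \<L>))"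

text \<open>\<open>harm_conj M y z x x'\<close> is \<open>H(y,z;x,x')\<close>: \<open>x'\<close> is a harmonic conjugate of \<open>x\<close> with respect
  to \<open>y\<close> and \<open>z\<close>.\<close>

definition harm_conj :: "'a matroid \<Rightarrow> 'a \<Rightarrow> 'a \<Rightarrow> 'a \<Rightarrow> 'a \<Rightarrow> bool" where
  "harm_conj M y z x x' \<longleftrightarrow>
     (\<exists>p q r s. HP M y x z p q r s \<and> cl M {y, z} \<inter> cl M {p, r} = {x'})"

text \<open>The order of the quantifiers expresses that the conjugate point exists for every
  configuration and depends only on \<open>y\<close>, \<open>x\<close>, \<open>z\<close>.\<close>

locale harmonic_matroid = simple_matroid +
  assumes harmonic:
    "\<And>y x z. \<exists>x'. \<forall>p q r s. HP M y x z p q r s \<longrightarrow> cl M {y, z} \<inter> cl M {p, r} = {x'}"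

definition harm_step :: "'a matroid \<Rightarrow> 'a set \<Rightarrow> 'a set" where
  "harm_step M S = S \<union> {x \<in> ground M. \<exists>a\<in>S. \<exists>b\<in>S. \<exists>c\<in>S. harm_conj M a c b x}"

definition harm_closure :: "'a matroid \<Rightarrow> 'a set \<Rightarrow> 'a set" where
  "harm_closure M S = (\<Union>n. (harm_step M ^^ n) S)"

text \<open>The sequence \<open>A, a 0, a 1, \<dots>\<close> consists of \<open>A\<close> and the \<open>a i\<close> with \<open>i < N\<close>, so that finite
  sequences and infinite ones (\<open>N = \<infinity>\<close>) are both covered.\<close>

definition conjugate_sequence :: "'a matroid \<Rightarrow> 'a \<Rightarrow> (nat \<Rightarrow> 'a) \<Rightarrow> enat \<Rightarrow> bool" where
  "conjugate_sequence M A a N \<longleftrightarrow>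
     A \<in> ground M \<and> (\<forall>i. enat i < N \<longrightarrow> a i \<in> ground M) \<and>
     (\<forall>i\<ge>1. enat (i + 1) < N \<longrightarrow> harm_conj M A (a i) (a (i - 1)) (a (i + 1)))"

definition repeats_at :: "'a \<Rightarrow> (nat \<Rightarrow> 'a) \<Rightarrow> nat \<Rightarrow> bool" where
  "repeats_at A a m \<longleftrightarrow> a m \<in> insert A (a ` {..<m})"

text \<open>\<open>A, a 0, \<dots>, a (m - 1)\<close> is a modular sequence: it is the part preceding the first
  repetition \<open>a m\<close> in some conjugate sequence.\<close>

definition modular_sequence :: "'a matroid \<Rightarrow> 'a \<Rightarrow> (nat \<Rightarrow> 'a) \<Rightarrow> nat \<Rightarrow> bool" where
  "modular_sequence M A a m \<longleftrightarrow>
     (\<exists>N. conjugate_sequence M A a N \<and> enat m < N \<and>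
          repeats_at A a m \<and> (\<forall>k<m. \<not> repeats_at A a k))"

definition moebius_harmonic_net :: "'a matroid \<Rightarrow> 'a list \<Rightarrow> bool" where
  "moebius_harmonic_net M xs \<longleftrightarrow>
     set xs \<subseteq> ground M \<and> collinear_in M (set xs) \<and> harm_closure M (set xs) = set xs"

end

theory Submission
  imports Defs
begin

text \<open>
  The theorem holds because the whole projective plane over the integers modulo \<open>n + 1\<close> can be built
  inside the matroid by harmonic conjugation alone, with \<open>d, b 0, \<dots>, b n\<close> as one of its lines, and
  a harmonic conjugate may be computed from any configuration that happens to be available.

  A matroid need not contain the intersection point of two coplanar lines. Harmonicity supplies
  some of these points. The configuration \<open>HP\<close> is a complete quadrangle \<open>y, z, q, s\<close> together with
  its three diagonal points \<open>x, p, r\<close> (\<open>HP_iff_quad\<close>). All six sides of the quadrangle play the same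
  part, so the line through two diagonal points meets both sides through the third one.
  A harmonic conjugate, moreover, does not depend on the configuration; this replaces every
  appeal to Desargues' theorem.

  Fix one configuration with \<open>y = d\<close>, \<open>x = b 0\<close>, \<open>z = b 1\<close> and use coordinates in which \<open>b i\<close> is
  \<open>(i, 0)\<close>, \<open>q\<close> and \<open>p\<close> are \<open>c 0 = (0, 1)\<close> and \<open>c 1 = (1, 1)\<close>, and \<open>d\<close>, \<open>s = s 0\<close>, \<open>r = s 1\<close> are the points
  at infinity in the directions \<open>(1, 0)\<close>, \<open>(0, 1)\<close> and \<open>(1, -1)\<close>. Extending the configuration step by step
  in both directions gives points \<open>b i\<close>, \<open>c i\<close>, \<open>s i\<close> for all integers \<open>i\<close> on three lines through \<open>d\<close>
  such that \<open>b i\<close>, \<open>c j\<close>, \<open>s (i - j)\<close> are always collinear (\<open>strip_exists\<close>).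
  That the extensions fit together is where uniqueness of the conjugate enters.
  The same construction, applied with the vertical direction \<open>V = s 0\<close> as centre
  to the columns through \<open>b i\<close> and \<open>b (i + 1)\<close>, yields points \<open>P i j\<close> for all integers \<open>i\<close>, \<open>j\<close> and
  directions \<open>D m\<close> of slope \<open>m\<close>, in which \<open>P i j\<close>, \<open>P (i + 1) (j + m)\<close>, \<open>D m\<close> are collinear
  (\<open>plane_exists\<close>).

  The conjugate sequence \<open>b\<close> coincides with the row \<open>P i 0\<close> since each of its points is the
  harmonic conjugate of the preceding ones. If it is modular, the row has period \<open>p = n + 1\<close>, and by the
  incidences all of \<open>P\<close> and \<open>D\<close> have this period in every coordinate. The period is a prime:
  if \<open>p\<close> divides \<open>m * k\<close> but not \<open>k\<close>, then the line of slope \<open>m\<close> through \<open>P 0 0\<close> passes through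
  \<open>P k (m * k) = P k 0\<close>, so it is the row and \<open>m\<close> is divisible by \<open>p\<close> (\<open>period_prime\<close>). Hence slopes can be
  divided modulo \<open>p\<close>, every line of nonzero slope meets the row in some \<open>P t 0\<close>, and for any three
  points of the row there is an explicit quadrangle of the plane whose conjugate point lies on
  the row (\<open>row_conj_at_infinity\<close>, \<open>row_conj_of_infinity\<close>, \<open>row_conj_finite\<close>). By uniqueness
  it is the harmonic conjugate, so the row is closed. For \<open>n = 0\<close> there is no configuration to start from, but two
  points have no harmonic conjugates at all.
\<close>

section \<open>Two-sided sequences and small subsets\<close>

text \<open>Dependent choice in both directions from a starting state; the indices of the states
  may enter their invariant.\<close>

lemma two_sided_chain:
  fixes x0 :: 's
  assumes "P 0 x0"
    and up: "\<And>i x. P i x \<Longrightarrow> \<exists>y. P (i + 1) y \<and> R x y"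
    and down: "\<And>i y. P i y \<Longrightarrow> \<exists>x. P (i - 1) x \<and> R x y"
  shows "\<exists>f :: int \<Rightarrow> 's. f 0 = x0 \<and> (\<forall>i. P i (f i) \<and> R (f i) (f (i + 1)))"
proof -
  have "\<exists>g. \<forall>n. (P (int n) (g n) \<and> (n = 0 \<longrightarrow> g n = x0)) \<and> R (g n) (g (Suc n))"
  proof (rule dependent_nat_choice)
    show "\<exists>x. P (int 0) x \<and> (0 = (0::nat) \<longrightarrow> x = x0)" using assms(1) by auto
    show "\<exists>y. (P (int (Suc n)) y \<and> (Suc n = 0 \<longrightarrow> y = x0)) \<and> R x y"
      if "P (int n) x \<and> (n = 0 \<longrightarrow> x = x0)" for n x
      using up[of "int n" x] that by (simp add: add.commute)
  qed
  then obtain g where g: "\<And>n. P (int n) (g n)" "g 0 = x0" "\<And>n. R (g n) (g (Suc n))" by blast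
  have "\<exists>h. \<forall>n. (P (- int n) (h n) \<and> (n = 0 \<longrightarrow> h n = x0)) \<and> R (h (Suc n)) (h n)"
  proof (rule dependent_nat_choice)
    show "\<exists>x. P (- int 0) x \<and> (0 = (0::nat) \<longrightarrow> x = x0)" using assms(1) by auto
    show "\<exists>x. (P (- int (Suc n)) x \<and> (Suc n = 0 \<longrightarrow> x = x0)) \<and> R x y"
      if "P (- int n) y \<and> (n = 0 \<longrightarrow> y = x0)" for n y
    proof -
      have "- int (Suc n) = - int n - 1" by simp
      then show ?thesis using down[of "- int n" y] that
        unfolding \<open>- int (Suc n) = - int n - 1\<close> by blast
    qed
  qed
  then obtain h where h: "\<And>n. P (- int n) (h n)" "h 0 = x0" "\<And>n. R (h (Suc n)) (h n)" by blast
  define f where "f i = (if i \<ge> 0 then g (nat i) else h (nat (- i)))" for i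
  have "P i (f i)" for i
    using g(1)[of "nat i"] h(1)[of "nat (- i)"] by (auto simp: f_def)
  moreover have "R (f i) (f (i + 1))" for i
  proof (cases "i \<ge> 0")
    case True
    then show ?thesis using g(3)[of "nat i"] by (simp add: f_def nat_add_distrib)
  next
    case False
    then have "nat (- i) = Suc (nat (- (i + 1)))" by simp
    then have "R (h (nat (- i))) (h (nat (- (i + 1))))" using h(3) by simp
    moreover have "f (i + 1) = h (nat (- (i + 1)))"
      using False g(2) h(2) by (cases "i = -1") (auto simp: f_def)
    ultimately show ?thesis using False by (simp add: f_def)
  qed
  moreover have "f 0 = x0" using g(2) by (simp add: f_def)
  ultimately show ?thesis by blast
qed

lemma periodic_eq_of_dvd:
  fixes f :: "int \<Rightarrow> 'b" and q :: int
  assumes "\<And>i. f (i + q) = f i" "q dvd i - j"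
  shows "f i = f j"
proof -
  have "f (j + q * k) = f j" for k
  proof (induction k rule: int_induct[where k = 0])
    case (step1 k)
    then show ?case using assms(1)[of "j + q * k"] by (simp add: algebra_simps)
  next
    case (step2 k)
    then show ?case using assms(1)[of "j + q * (k - 1)"] by (simp add: algebra_simps)
  qed simp
  moreover obtain k where "i - j = q * k" using assms(2) by (rule dvdE)
  then have "i = j + q * k" by simp
  ultimately show ?thesis by simp
qed

text \<open>As a rewrite rule, this enumerates the subsets of a given size of an explicit finite set, here
  the 35 triples in a configuration of seven points.\<close>

lemma subsets_of_card_insert:
  assumes "a \<notin> S" "finite S"
  shows "{T. T \<subseteq> insert a S \<and> card T = Suc k} =
    {T. T \<subseteq> S \<and> card T = Suc k} \<union> insert a ` {T. T \<subseteq> S \<and> card T = k}" (is "?L = ?R")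
proof
  show "?L \<subseteq> ?R"
  proof
    fix T assume T: "T \<in> ?L"
    then have f: "finite T" using assms(2) finite_subset by fastforce
    show "T \<in> ?R"
    proof (cases "a \<in> T")
      case True
      then have "T = insert a (T - {a})" "T - {a} \<subseteq> S" "card (T - {a}) = k" using T f by auto
      then show ?thesis by blast
    next
      case False
      then show ?thesis using T by blast
    qed
  qed
next
  have "card (insert a T) = Suc (card T)" if "T \<subseteq> S" for T
    using that assms finite_subset[of T S] by (intro card_insert_disjoint) auto
  then show "?R \<subseteq> ?L" by auto
qed

lemma subsets_of_card_0: "finite S \<Longrightarrow> {T. T \<subseteq> S \<and> card T = 0} = {{}}"
  using finite_subset by fastforce

lemma subsets_of_empty: "{T. T = {} \<and> card T = Suc k} = {}" "{T. T = {} \<and> card T = 0} = {{}}"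
  by auto

section \<open>Rank and collinearity\<close>

context matroid begin

lemma cl_subset_cl:
  assumes "X \<subseteq> cl M Y" "Y \<subseteq> ground M"
  shows "cl M X \<subseteq> cl M Y"
  using cl_mono[OF assms(1) cl_subset_ground[OF assms(2)]] cl_idem[OF assms(2)] by simp

text \<open>Steinitz exchange: an element of \<open>I\<close> outside \<open>F\<close> can be traded for one of \<open>F\<close>. Only finite
  sets matter, since \<open>mrank\<close> is a supremum over them.\<close>

lemma card_indep_le_spanning:
  assumes "finite F" "F \<subseteq> ground M" "finite I" "indep M I" "I \<subseteq> cl M F"
  shows "card I \<le> card F"
  using assms(3-5)
proof (induction "card (I - F)" arbitrary: I rule: less_induct)
  case (less I)
  have IG: "I \<subseteq> ground M"
    using less.prems(2) by (simp add: indep_def)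
  show ?case
  proof (cases "I \<subseteq> F")
    case True
    then show ?thesis using assms(1) by (simp add: card_mono)
  next
    case False
    then obtain x where x: "x \<in> I" "x \<notin> F" by blast
    have xcl: "x \<notin> cl M (I - {x})"
      using less.prems(2) x by (simp add: indep_def)
    have "\<not> F \<subseteq> cl M (I - {x})"
    proof
      assume "F \<subseteq> cl M (I - {x})"
      then have "cl M F \<subseteq> cl M (I - {x})"
        using IG by (intro cl_subset_cl) auto
      then show False using xcl x less.prems(3) by blast
    qed
    then obtain f where f: "f \<in> F" "f \<notin> cl M (I - {x})" by blast
    have fG: "f \<in> ground M" using f assms(2) by blast
    have fI: "f \<notin> I"
      using f x cl_extensive[of "I - {x}"] IG by blast
    let ?J = "insert f (I - {x})"
    have "indep M ?J"
      unfolding indep_def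
    proof (intro conjI ballI)
      show "?J \<subseteq> ground M" using fG IG by blast
    next
      fix g assume g: "g \<in> ?J"
      show "g \<notin> cl M (?J - {g})"
      proof (cases "g = f")
        case True
        then show ?thesis using f fI by simp
      next
        case False
        then have gI: "g \<in> I" "g \<noteq> x" using g by auto
        have eq1: "?J - {g} = insert f (I - {x} - {g})" using False by blast
        have eq2: "insert g (I - {x} - {g}) = I - {x}" using gI by blast
        have "cl M (I - {x} - {g}) \<subseteq> cl M (I - {g})"
          using IG by (intro cl_mono) auto
        then have "g \<notin> cl M (I - {x} - {g})"
          using less.prems(2) gI by (auto simp: indep_def)
        then show ?thesis
          using cl_exchange[of "I - {x} - {g}" f g] f fG IG unfolding eq1 eq2 by blast
      qed
    qed
    moreover have "card (?J - F) < card (I - F)"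
      using f x less.prems(1) by (intro psubset_card_mono) auto
    moreover have "?J \<subseteq> cl M F"
      using f less.prems(3) cl_extensive[OF assms(2)] by blast
    ultimately have "card ?J \<le> card F"
      using less.hyps less.prems(1) by blast
    moreover have "card ?J = card I"
      using x fI less.prems(1) card.remove[of I x] by simp
    ultimately show ?thesis by simp
  qed
qed

lemma mrank_le_card_spanning:
  assumes "finite F" "F \<subseteq> ground M" "X \<subseteq> cl M F"
  shows "mrank M X \<le> enat (card F)"
  unfolding mrank_def using assms card_indep_le_spanning
  by (intro SUP_least) (auto intro: order_trans)

lemma card_indep_le_mrank:
  assumes "finite I" "indep M I" "I \<subseteq> X"
  shows "enat (card I) \<le> mrank M X"
  unfolding mrank_def using assms by (intro SUP_upper) auto

lemma mrank_restriction:
  assumes "Y \<subseteq> X" "X \<subseteq> ground M"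
  shows "mrank (restriction M X) Y = mrank M Y"
proof -
  have "indep (restriction M X) I \<longleftrightarrow> indep M I" if "I \<subseteq> Y" for I
    using that assms by (auto simp: indep_def restriction_def)
  then have "{I. I \<subseteq> Y \<and> finite I \<and> indep (restriction M X) I} =
      {I. I \<subseteq> Y \<and> finite I \<and> indep M I}"
    by auto
  then show ?thesis by (simp add: mrank_def)
qed

end

context simple_matroid begin

text \<open>In contrast to \<open>collinear_in\<close>, coinciding points are admitted in any position. This makes the relation symmetric
  and leaves a single inequality to be checked in \<open>col_trans\<close>.\<close>

definition col :: "'a \<Rightarrow> 'a \<Rightarrow> 'a \<Rightarrow> bool" where
  "col x y z \<longleftrightarrow> {x, y, z} \<subseteq> ground M \<and> (x = y \<or> z \<in> cl M {x, y})"

lemma col_ground: "col x y z \<Longrightarrow> x \<in> ground M \<and> y \<in> ground M \<and> z \<in> ground M"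
  by (simp add: col_def)

lemma col_triv: "x \<in> ground M \<Longrightarrow> y \<in> ground M \<Longrightarrow> col x x y \<and> col x y x \<and> col y x x"
  using cl_extensive[of "{x, y}"] by (auto simp: col_def insert_commute)

lemma col_swap12: "col x y z \<Longrightarrow> col y x z"
  by (auto simp: col_def insert_commute)

lemma col_swap23: "col x y z \<Longrightarrow> col x z y"
  using cl_exchange[of "{x}" y z] cl_singleton[of x] cl_extensive[of "{x, z}"]
  by (auto simp: col_def insert_commute)

lemma col_trans:
  assumes "col x y z" "col x y w" "x \<noteq> y"
  shows "col x z w"
proof (cases "x = z")
  case False
  have "y \<in> cl M {x, z}"
    using col_swap23[OF assms(1)] False by (simp add: col_def)
  then have "cl M {x, y} \<subseteq> cl M {x, z}"
    using col_ground[OF assms(1)] cl_extensive[of "{x, z}"] by (intro cl_subset_cl) auto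
  then show ?thesis using assms by (auto simp: col_def)
qed (use assms in \<open>auto simp: col_def\<close>)

lemma cl_pair_iff_col:
  "x \<noteq> y \<Longrightarrow> x \<in> ground M \<Longrightarrow> y \<in> ground M \<Longrightarrow> z \<in> cl M {x, y} \<longleftrightarrow> col x y z"
  using cl_subset_ground[of "{x, y}"] by (auto simp: col_def)

text \<open>Ordered rewriting with these equations brings the three arguments into a normal
  order, so that \<open>simp\<close> finds a collinearity fact in whichever order it was proved.\<close>

lemma col_commute: "col x y z \<longleftrightarrow> col y x z" "col x y z \<longleftrightarrow> col x z y"
  using col_swap12 col_swap23 by blast+

lemma indep_pair: "x \<noteq> y \<Longrightarrow> x \<in> ground M \<Longrightarrow> y \<in> ground M \<Longrightarrow> indep M {x, y}"
  by (auto simp: indep_def cl_singleton insert_Diff_if)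

lemma noncol_move: "\<not> col a b c \<Longrightarrow> col a b d \<Longrightarrow> a \<noteq> d \<Longrightarrow> \<not> col a d c"
  using col_trans[of a d b c] col_commute(2)[of a d b] by blast

lemma col_of_common_line:
  assumes "a \<noteq> b" "col a b x" "col a b y" "col a b z"
  shows "col x y z"
proof (cases "x = a")
  case True
  then show ?thesis using col_trans[OF assms(3,4)] assms(1) col_trans[of a b y z] assms by simp
next
  case False
  have "col a x y" "col a x z" using col_trans[of a b x] assms by simp_all
  then show ?thesis using col_trans[of x a y z] False by (simp add: col_commute)
qed

lemma indep_triple:
  assumes "x \<in> ground M" "y \<in> ground M" "z \<in> ground M" "\<not> col x y z"
  shows "indep M {x, y, z}"
proof -
  have "x \<noteq> y" "y \<noteq> z" "x \<noteq> z" using assms col_triv by blast+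
  moreover have "\<not> col x z y" "\<not> col y z x" using assms(4) by (simp_all add: col_commute)
  ultimately show ?thesis using assms
    by (auto simp: indep_def insert_Diff_if cl_pair_iff_col)
qed

lemma collinear_triple:
  assumes "distinct [x, y, z]" "{x, y, z} \<subseteq> ground M"
  shows "collinear_in M {x, y, z} \<longleftrightarrow> col x y z"
proof
  assume c: "collinear_in M {x, y, z}"
  show "col x y z"
  proof (rule ccontr)
    assume "\<not> col x y z"
    then have "enat (card {x, y, z}) \<le> mrank M {x, y, z}"
      using assms by (intro card_indep_le_mrank indep_triple) auto
    then have "enat (card {x, y, z}) \<le> 2"
      using c unfolding collinear_in_def by (rule order_trans)
    then show False using assms by (simp add: numeral_eq_enat)
  qed
next
  assume "col x y z"
  then have "mrank M {x, y, z} \<le> enat (card {x, y})"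
    using assms cl_extensive[of "{x, y}"] by (intro mrank_le_card_spanning) (auto simp: col_def)
  then show "collinear_in M {x, y, z}"
    using assms by (simp add: collinear_in_def numeral_eq_enat numeral_2_eq_2)
qed

end

section \<open>Complete quadrangles\<close>

context simple_matroid begin

text \<open>The complete quadrangle \<open>y, z, q, s\<close> with its diagonal points \<open>x = yz \<inter> qs\<close>, \<open>p = yq \<inter> zs\<close> and
  \<open>r = ys \<inter> zq\<close>. The order of the arguments is that of \<open>HP\<close>.\<close>

definition quad :: "'a \<Rightarrow> 'a \<Rightarrow> 'a \<Rightarrow> 'a \<Rightarrow> 'a \<Rightarrow> 'a \<Rightarrow> 'a \<Rightarrow> bool" where
  "quad y x z p q r s \<longleftrightarrow>
     \<not> col y z q \<and> \<not> col y z s \<and> \<not> col y q s \<and> \<not> col z q s \<and>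
     col y z x \<and> col q s x \<and> col y q p \<and> col z s p \<and> col y s r \<and> col z q r"

text \<open>The symmetric group on the four vertices acts on quadrangles, permuting the diagonal
  points accordingly; it is generated by the first three transpositions.\<close>

lemma quad_swap_yz: "quad y x z p q r s \<Longrightarrow> quad z x y r q p s"
  by (simp add: quad_def col_commute)

lemma quad_swap_zq: "quad y x z p q r s \<Longrightarrow> quad y p q x z r s"
  by (simp add: quad_def col_commute)

lemma quad_swap_qs: "quad y x z p q r s \<Longrightarrow> quad y x z r s p q"
  by (simp add: quad_def col_commute)

lemma quad_swap_zs:
  assumes "quad y x z p q r s" shows "quad y r s p q x z"
  using assms by (simp add: quad_def col_commute)

lemma quad_ground: "quad y x z p q r s \<Longrightarrow> {y, x, z, p, q, r, s} \<subseteq> ground M"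
  by (auto simp: quad_def dest: col_ground)

lemma quad_noncol:
  assumes "quad y x z p q r s"
  shows "\<not> col y z p" "\<not> col y x p"
proof -
  have g: "\<not> col y q z" "\<not> col y q s" "\<not> col y z s" "\<not> col y z q" 
    "col y q p" "col y z x" "col z s p" "col q s x"
    using assms by (simp_all add: quad_def col_commute)
  have "p \<noteq> y" using g by (auto simp: col_commute)
  then have "\<not> col y p z" using noncol_move[of y q z p] g by blast
  then show *: "\<not> col y z p" by (simp add: col_commute)
  have "x \<noteq> y" using g by (auto simp: col_commute)
  then show "\<not> col y x p" using noncol_move[of y z p x] g * by blast
qed

text \<open>Up to the symmetries of the quadrangle, there are only three kinds of triples here: two vertices and a third one,
  two vertices and a diagonal point off their side, or one vertex and two diagonal points. The list
  omits just the six sides and the diagonal triple \<open>x, p, r\<close>, which may or may not be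
  collinear.\<close>

lemma quad_noncol_all:
  assumes "quad y x z p q r s"
  shows "\<not> col y z q" "\<not> col y z s" "\<not> col y q s" "\<not> col z q s"
    "\<not> col y z p" "\<not> col y z r" "\<not> col y q x" "\<not> col y q r" "\<not> col y s x" "\<not> col y s p"
    "\<not> col z q x" "\<not> col z q p" "\<not> col z s x" "\<not> col z s r" "\<not> col q s p" "\<not> col q s r"
    "\<not> col y x p" "\<not> col y x r" "\<not> col y p r" "\<not> col z x r" "\<not> col z x p" "\<not> col z r p"
    "\<not> col q x p" "\<not> col q x r" "\<not> col q p r" "\<not> col s x p" "\<not> col s x r" "\<not> col s p r"
proof -
  \<comment> \<open>the orbit of the quadrangle under all 24 permutations of its vertices, built up by cosets\<close>
  note a = assms quad_swap_qs[OF assms]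
  note b = a a[THEN quad_swap_zq] a[THEN quad_swap_zq, THEN quad_swap_qs]
  note c = b b[THEN quad_swap_yz] b[THEN quad_swap_yz, THEN quad_swap_zq]
    b[THEN quad_swap_yz, THEN quad_swap_zq, THEN quad_swap_qs]
  have "\<not> col y z q" "\<not> col y z s" "\<not> col y q s" "\<not> col z q s"
    using assms by (simp_all add: quad_def)
  moreover note c[THEN quad_noncol(1)] c[THEN quad_noncol(2)]
  ultimately show "\<not> col y z q" "\<not> col y z s" "\<not> col y q s" "\<not> col z q s"
    "\<not> col y z p" "\<not> col y z r" "\<not> col y q x" "\<not> col y q r" "\<not> col y s x" "\<not> col y s p"
    "\<not> col z q x" "\<not> col z q p" "\<not> col z s x" "\<not> col z s r" "\<not> col q s p" "\<not> col q s r"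
    "\<not> col y x p" "\<not> col y x r" "\<not> col y p r" "\<not> col z x r" "\<not> col z x p" "\<not> col z r p"
    "\<not> col q x p" "\<not> col q x r" "\<not> col q p r" "\<not> col s x p" "\<not> col s x r" "\<not> col s p r"
    by (simp_all add: col_commute)
qed

lemma quad_distinct:
  assumes "quad y x z p q r s"
  shows "distinct [y, x, z, p, q, r, s]"
  using quad_noncol_all[OF assms] quad_ground[OF assms] by (auto simp: col_triv)

lemma col_triple_mline:
  assumes "col a c b" "distinct [a, b, c]" "{a, b, c} \<subseteq> X" "X \<subseteq> ground M"
    and "\<And>w. w \<in> X \<Longrightarrow> col a c w \<Longrightarrow> w \<in> {a, b, c}"
  shows "mline (restriction M X) {a, b, c}"
proof -
  have g: "a \<in> ground M" "b \<in> ground M" "c \<in> ground M"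
    using col_ground[OF assms(1)] by auto
  have "b \<in> cl M {a, c}" using assms g by (simp add: cl_pair_iff_col)
  then have "cl M {a, b, c} \<subseteq> cl M {a, c}"
    using g cl_extensive[of "{a, c}"] by (intro cl_subset_cl) auto
  then have "cl M {a, b, c} \<inter> X \<subseteq> {a, b, c}"
    using assms g cl_pair_iff_col[of a c] by auto
  moreover have "{a, b, c} \<subseteq> cl M {a, b, c}" using g by (intro cl_extensive) auto
  ultimately have "cl M {a, b, c} \<inter> X = {a, b, c}" using assms by blast
  moreover have "mrank M {a, b, c} \<le> 2"
    using assms g collinear_triple[of a b c] by (auto simp: collinear_in_def col_commute)
  moreover have "enat (card {a, c}) \<le> mrank M {a, b, c}"
    using assms g by (intro card_indep_le_mrank indep_pair) auto
  ultimately show ?thesis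
    using assms mrank_restriction[of "{a, b, c}" X]
    by (auto simp: mline_def restriction_def numeral_eq_enat numeral_2_eq_2)
qed

lemma mline_collinear:
  assumes "mline (restriction M X) {a, b, c}" "distinct [a, b, c]" "X \<subseteq> ground M"
  shows "col a b c"
proof -
  have "{a, b, c} \<subseteq> X" using assms(1) by (simp add: mline_def restriction_def)
  then show ?thesis
    using assms mrank_restriction[of "{a, b, c}" X] collinear_triple[of a b c]
    by (auto simp: mline_def collinear_in_def)
qed

lemma quad_collinear_triples:
  assumes Q: "quad y x z p q r s" and X: "X = {y, x, z, p, q, r, s}"
    and T: "T \<subseteq> X" "card T = 3" "collinear_in M T"
  shows "T \<in> {{y, x, z}, {y, p, q}, {y, r, s}, {x, q, s}, {z, p, s}, {z, q, r}} \<or>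
     T = {x, p, r} \<and> col x p r"
proof -
  note d = quad_distinct[OF Q] and n = quad_noncol_all[OF Q] and g = quad_ground[OF Q]
  have d': "distinct [s, r, q, p, z, x, y]" using d by auto
  have "T \<in> {T. T \<subseteq> {y, x, z, p, q, r, s} \<and> card T = Suc (Suc (Suc 0))}"
    using T X by (simp add: numeral_3_eq_3)
  then show ?thesis
    using d
    apply (simp add: subsets_of_card_insert subsets_of_card_0 subsets_of_empty image_Un
        del: card_0_eq One_nat_def mem_Collect_eq)
    apply (elim disjE)
    using d' g T(3) n
    by (simp_all add: collinear_triple col_commute insert_commute)
qed

lemma quad_imp_HP:
  assumes Q: "quad y x z p q r s"
  shows "HP M y x z p q r s"
proof -
  define X where "X = {y, x, z, p, q, r, s}"
  define N where "N = restriction M X"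
  define \<T> where "\<T> = {{y, x, z}, {y, p, q}, {y, r, s}, {x, q, s}, {z, p, s}, {z, q, r}}"
  define \<L> where "\<L> = {L. mline N L \<and> card L = 3}"
  note d = quad_distinct[OF Q] and n = quad_noncol_all[OF Q]
  have g: "X \<subseteq> ground M" using quad_ground[OF Q] by (simp add: X_def)
  have g': "y \<in> ground M" "x \<in> ground M" "z \<in> ground M"
    "p \<in> ground M" "q \<in> ground M" "r \<in> ground M" "s \<in> ground M"
    using g by (auto simp: X_def)
  have i: "col y z x" "col q s x" "col y q p" "col z s p" "col y s r" "col z q r"
    using Q by (simp_all add: quad_def)
  have lines: "mline N {y, x, z}" "mline N {y, p, q}" "mline N {y, r, s}" "mline N {x, q, s}"
     "mline N {z, p, s}" "mline N {z, q, r}"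
    unfolding N_def using d i n g
    by (intro col_triple_mline; force simp: X_def col_commute)+
  have line: "mline N {x, p, r}" if "col x p r"
    unfolding N_def using d that n g
    by (intro col_triple_mline; force simp: X_def col_commute)
  have triples: "T \<in> \<T> \<or> T = {x, p, r} \<and> col x p r"
    if "T \<subseteq> X" "card T = 3" "collinear_in N T" for T
    using quad_collinear_triples[OF Q X_def that(1,2)] that mrank_restriction[of T X] g
    unfolding \<T>_def by (simp add: collinear_in_def N_def)
  have "L \<subseteq> X" "collinear_in N L" if "mline N L" for L
    using that by (auto simp: mline_def N_def restriction_def collinear_in_def)
  then have sub: "L \<in> \<T> \<or> L = {x, p, r} \<and> col x p r" if "L \<in> \<L>" for L
    using that triples by (auto simp: \<L>_def)
  have card3: "card L = 3" if "L \<in> insert {x, p, r} \<T>" for L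
    using that d by (auto simp: \<T>_def)
  have sup: "\<T> \<subseteq> \<L>"
    using lines card3 by (auto simp: \<L>_def \<T>_def)
  have supl: "col x p r \<Longrightarrow> {x, p, r} \<in> \<L>"
    using line card3 by (auto simp: \<L>_def)
  have L: "\<L> = \<T> \<or> \<L> = insert {x, p, r} \<T>"
    using sub sup supl by blast
  have T: "\<forall>T. T \<subseteq> X \<and> card T = 3 \<and> collinear_in N T \<longrightarrow> T \<in> \<L>"
    using triples sup supl by blast
  have "mrank N X = 3"
  proof (rule antisym)
    \<comment> \<open>\<open>y, z, q\<close> span the configuration: \<open>s\<close> lies on the line through \<open>x\<close> and \<open>q\<close>\<close>
    have "x \<in> cl M {y, z, q}"
      using cl_mono[of "{y, z}" "{y, z, q}"] i d g' by (auto simp: cl_pair_iff_col[symmetric])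
    moreover have "s \<in> cl M {x, q}"
      using i d g' by (simp add: cl_pair_iff_col col_commute)
    moreover have sp: "w \<in> cl M {y, z, q}"
      if "w \<in> cl M {u, v}" "u \<in> cl M {y, z, q}" "v \<in> cl M {y, z, q}" for u v w
      using cl_subset_cl[of "{u, v}" "{y, z, q}"] that g' by blast
    moreover have base: "y \<in> cl M {y, z, q}" "z \<in> cl M {y, z, q}" "q \<in> cl M {y, z, q}"
      using cl_extensive[of "{y, z, q}"] g' by auto
    moreover have "p \<in> cl M {y, q}" "r \<in> cl M {z, q}"
      using i d g' by (simp_all add: cl_pair_iff_col col_commute)
    ultimately have "X \<subseteq> cl M {y, z, q}" unfolding X_def by blast
    then have "mrank M X \<le> enat (card {y, z, q})"
      using g' by (intro mrank_le_card_spanning) auto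
    then show "mrank N X \<le> 3"
      using d g by (simp add: N_def mrank_restriction numeral_eq_enat numeral_3_eq_3)
    have "enat (card {y, z, q}) \<le> mrank M X"
      using g' n by (intro card_indep_le_mrank indep_triple) (auto simp: X_def)
    then show "3 \<le> mrank N X"
      using d g by (simp add: N_def mrank_restriction numeral_eq_enat numeral_3_eq_3)
  qed
  moreover have "ground N = X" by (simp add: N_def restriction_def)
  ultimately show ?thesis
    using d g L T
    unfolding HP_def Let_def X_def[symmetric] N_def[symmetric] \<T>_def[symmetric] \<L>_def[symmetric]
    by simp
qed

lemma HP_imp_quad:
  assumes HP: "HP M y x z p q r s"
  shows "quad y x z p q r s"
proof -
  define X where "X = {y, x, z, p, q, r, s}"
  define N where "N = restriction M X"
  define \<T> where "\<T> = {{y, x, z}, {y, p, q}, {y, r, s}, {x, q, s}, {z, p, s}, {z, q, r}}"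
  define \<L> where "\<L> = {L. mline N L \<and> card L = 3}"
  have d: "distinct [y, x, z, p, q, r, s]" and g: "X \<subseteq> ground M"
    and L: "\<L> = \<T> \<or> \<L> = insert {x, p, r} \<T>"
    and T: "T \<subseteq> X \<Longrightarrow> card T = 3 \<Longrightarrow> collinear_in N T \<Longrightarrow> T \<in> \<L>" for T
    using HP unfolding HP_def Let_def X_def[symmetric] N_def[symmetric] \<T>_def[symmetric] \<L>_def[symmetric]
    by (auto simp: N_def restriction_def)
  have line: "mline N A" if "A \<in> \<T>" for A using that L by (auto simp: \<L>_def)
  have c: "col a b c" if "{a, b, c} \<in> \<T>" "distinct [a, b, c]" for a b c
    using mline_collinear[OF _ that(2) g] line[OF that(1)] by (simp add: N_def)
  have n: "\<not> col a b c"
    if "{a, b, c} \<subseteq> X" "distinct [a, b, c]" "{a, b, c} \<notin> insert {x, p, r} \<T>" for a b c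
  proof
    assume "col a b c"
    then have "collinear_in N {a, b, c}"
      using collinear_triple[of a b c] that g mrank_restriction[of "{a, b, c}" X]
      by (auto simp: collinear_in_def N_def)
    then show False using T[of "{a, b, c}"] that L by auto
  qed
  have d': "distinct [s, r, q, p, z, x, y]" using d by auto
  have "col y x z" "col x q s" "col y p q" "col z p s" "col y r s" "col z q r"
    using d by (intro c; simp add: \<T>_def)+
  moreover have "\<not> col y z q" "\<not> col y z s" "\<not> col y q s" "\<not> col z q s"
    using d d' by (intro n; simp add: X_def \<T>_def set_eq_subset)+
  ultimately show ?thesis
    using g by (simp add: quad_def X_def col_commute)
qed

text \<open>The seven-point restriction, with its rank and its flats, is thereby reduced to collinearity of
  triples in the whole matroid.\<close>

lemma HP_iff_quad: "HP M y x z p q r s \<longleftrightarrow> quad y x z p q r s"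
  using HP_imp_quad quad_imp_HP by blast

text \<open>For points \<open>b0 = (0, 0)\<close>, \<open>b1 = (1, 0)\<close>, \<open>c0 = (0, 1)\<close>, \<open>c1 = (1, 1)\<close> and directions \<open>s0 = (0, 1)\<close>, \<open>s1 = (1, -1)\<close>,
  \<open>A = (1, 0)\<close>, the second diagonal of the unit square \<open>b0, b1, c1, c0\<close>, which joins \<open>b0\<close> to \<open>c1\<close>, may have no
  point at infinity in the matroid. If it has one, \<open>s'\<close>, then the square can be traversed in the
  opposite direction.\<close>

lemma quad_reverse:
  assumes Q: "quad A b0 b1 c1 c0 s1 s0" and "col A s0 s'" "col b0 c1 s'"
  shows "quad A b1 b0 c0 c1 s' s0"
  using quad_noncol_all[OF Q] assms by (simp add: quad_def col_commute)

end

section \<open>Harmonic conjugates\<close>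

context harmonic_matroid begin

text \<open>The fourth harmonic point, restated by collinearity. The quantifiers put \<open>w\<close> before the
  configuration: all quadrangles with the same \<open>y, x, z\<close> share the point. Existence is contained
  in the equivalence, taken at \<open>v = w\<close>.\<close>

lemma quad_conj_unique:
  "\<exists>w. \<forall>p q r s v. quad y x z p q r s \<longrightarrow> (col y z v \<and> col p r v \<longleftrightarrow> v = w)"
proof -
  obtain w where w: "\<And>p q r s. quad y x z p q r s \<Longrightarrow> cl M {y, z} \<inter> cl M {p, r} = {w}"
    using harmonic[of y x z] unfolding HP_iff_quad by blast
  have "col y z v \<and> col p r v \<longleftrightarrow> v = w" if Q: "quad y x z p q r s" for p q r s v
  proof -
    have "y \<noteq> z" "p \<noteq> r" "{y, z, p, r} \<subseteq> ground M"
      using quad_distinct[OF Q] quad_ground[OF Q] by auto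
    then have "v \<in> cl M {y, z} \<inter> cl M {p, r} \<longleftrightarrow> col y z v \<and> col p r v"
      by (simp add: cl_pair_iff_col)
    then show ?thesis using w[OF Q] by simp
  qed
  then show ?thesis by blast
qed

lemma harm_conj_iff:
  "harm_conj M y z x w \<longleftrightarrow> (\<exists>p q r s. quad y x z p q r s \<and> col y z w \<and> col p r w)"
proof -
  have "cl M {y, z} \<inter> cl M {p, r} = {w} \<longleftrightarrow> col y z w \<and> col p r w"
    if Q: "quad y x z p q r s" for p q r s
  proof -
    obtain w' where w': "\<And>v. col y z v \<and> col p r v \<longleftrightarrow> v = w'"
      using quad_conj_unique[of y x z] Q by blast
    have "y \<noteq> z" "p \<noteq> r" "{y, z, p, r} \<subseteq> ground M"
      using quad_distinct[OF Q] quad_ground[OF Q] by auto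
    then have "cl M {y, z} \<inter> cl M {p, r} = {w'}"
      by (intro set_eqI) (simp add: cl_pair_iff_col w')
    then show ?thesis using w'[of w] by auto
  qed
  then show ?thesis unfolding harm_conj_def HP_iff_quad by (simp cong: conj_cong)
qed

lemma quad_conj_exists:
  assumes Q: "quad y x z p q r s"
  obtains w where "col y z w" "col p r w"
  using quad_conj_unique[of y x z] Q that by blast

lemma harm_conj_unique:
  assumes "harm_conj M y z x v" "harm_conj M y z x w"
  shows "v = w"
proof -
  obtain w' where "\<And>p q r s v. quad y x z p q r s \<Longrightarrow> col y z v \<and> col p r v \<Longrightarrow> v = w'"
    using quad_conj_unique[of y x z] by blast
  then show ?thesis using assms unfolding harm_conj_iff by blast
qed

lemma harm_conj_sym: "harm_conj M y z x w \<longleftrightarrow> harm_conj M z y x w"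
  unfolding harm_conj_iff using quad_swap_yz col_commute by blast

text \<open>Advancing the configuration by one unit along the line of \<open>c0, c1\<close> while \<open>b0, b1\<close> stay. The direction \<open>s'\<close>
  of the second diagonal is the intersection with \<open>A s0\<close> of the line through the diagonal points \<open>b0\<close> and \<open>c1\<close>; in the
  reversed quadrangle, \<open>c2\<close> arises in the same way.\<close>

lemma quad_next:
  assumes Q: "quad A b0 b1 c1 c0 s1 s0"
  shows "\<exists>c2 s'. quad A b0 b1 c2 c1 s0 s'"
proof -
  obtain s' where s': "col A s0 s'" "col c1 b0 s'"
    using quad_conj_exists[OF quad_swap_zs[OF Q]] by blast
  have R: "quad A b1 b0 c0 c1 s' s0"
    using quad_reverse[OF Q] s' by (simp add: col_commute)
  obtain c2 where "col A c1 c2" "col b1 s' c2"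
    using quad_conj_exists[OF quad_swap_zq[OF R]] by blast
  then have "quad A b0 b1 c2 c1 s0 s'"
    using Q quad_noncol_all[OF Q] quad_noncol_all[OF R] s' by (simp add: quad_def col_commute)
  then show ?thesis by blast
qed

text \<open>The roles of the \<open>c\<close> and the \<open>s\<close> are symmetric, and exchanging them reverses the direction.\<close>

lemma quad_prev:
  assumes Q: "quad A b0 b1 c1 c0 s1 s0"
  shows "\<exists>c' s2. quad A b0 b1 c0 c' s2 s1"
  using quad_next[OF quad_swap_qs[OF Q]] quad_swap_qs by blast

end

section \<open>Strips: three concurrent lines\<close>

context harmonic_matroid begin

text \<open>All configurations obtained from one pair \<open>b0, b1\<close>. The indices satisfy the rule that \<open>b i\<close>, \<open>c j\<close>,
  \<open>s k\<close> are collinear for \<open>i - j = k\<close>, restricted to \<open>i = 0, 1\<close>.\<close>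

definition ladder :: "'a \<Rightarrow> 'a \<Rightarrow> 'a \<Rightarrow> (int \<Rightarrow> 'a) \<Rightarrow> (int \<Rightarrow> 'a) \<Rightarrow> bool" where
  "ladder A b0 b1 c s \<longleftrightarrow> (\<forall>j. quad A b0 b1 (c (j + 1)) (c j) (s (1 - j)) (s (- j)))"

lemma ladder_exists:
  assumes "quad A b0 b1 c1 c0 s1 s0"
  shows "\<exists>c s. ladder A b0 b1 c s \<and> c 0 = c0 \<and> c 1 = c1 \<and> s 0 = s0 \<and> s 1 = s1"
proof -
  \<comment> \<open>a state consists of \<open>c j\<close>, \<open>c (j + 1)\<close>, \<open>s (1 - j)\<close> and \<open>s (- j)\<close>\<close>
  define P :: "int \<Rightarrow> 'a \<times> 'a \<times> 'a \<times> 'a \<Rightarrow> bool"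
    where "P i = (\<lambda>(c, c', s', s). quad A b0 b1 c' c s' s)" for i
  define R :: "'a \<times> 'a \<times> 'a \<times> 'a \<Rightarrow> 'a \<times> 'a \<times> 'a \<times> 'a \<Rightarrow> bool"
    where "R = (\<lambda>(c, c', s', s) (d, d', t', t). d = c' \<and> t' = s)"
  have "\<exists>f. f 0 = (c0, c1, s1, s0) \<and> (\<forall>i. P i (f i) \<and> R (f i) (f (i + 1)))"
  proof (rule two_sided_chain)
    show "P 0 (c0, c1, s1, s0)" using assms by (simp add: P_def)
    show "\<exists>y. P (i + 1) y \<and> R x y" if Px: "P i x" for i x
    proof -
      obtain c c' s' s where x: "x = (c, c', s', s)" by (cases x) auto
      then have "quad A b0 b1 c' c s' s" using Px by (simp add: P_def)
      then obtain c'' s'' where "quad A b0 b1 c'' c' s s''" using quad_next by blast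
      then have "P (i + 1) (c', c'', s, s'')" "R x (c', c'', s, s'')" by (auto simp: P_def R_def x)
      then show ?thesis by blast
    qed
    show "\<exists>x. P (i - 1) x \<and> R x y" if Py: "P i y" for i y
    proof -
      obtain c c' s' s where y: "y = (c, c', s', s)" by (cases y) auto
      then have "quad A b0 b1 c' c s' s" using Py by (simp add: P_def)
      then obtain c'' s'' where "quad A b0 b1 c c'' s'' s'" using quad_prev by blast
      then have "P (i - 1) (c'', c, s'', s')" "R (c'', c, s'', s') y" by (auto simp: P_def R_def y)
      then show ?thesis by blast
    qed
  qed
  then obtain f where f: "f 0 = (c0, c1, s1, s0)" "\<And>i. P i (f i)" "\<And>i. R (f i) (f (i + 1))" by blast
  define c where "c j = fst (f j)" for j
  define s where "s k = snd (snd (snd (f (- k))))" for k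
  have c': "fst (snd (f j)) = c (j + 1)" for j
    using f(3)[of j] by (simp add: R_def c_def case_prod_beta)
  have s': "fst (snd (snd (f j))) = s (1 - j)" for j
    using f(3)[of "j - 1"] by (simp add: R_def s_def case_prod_beta)
  have "quad A b0 b1 (c (j + 1)) (c j) (s (1 - j)) (s (- j))" for j
    using f(2)[of j] c'[of j] s'[of j] by (simp add: P_def c_def[of j] s_def[of "- j"] case_prod_beta)
  then show ?thesis
    using f(1) c'[of 0] s'[of 0] by (intro exI[of _ c] exI[of _ s]) (simp add: ladder_def c_def s_def)
qed

lemma ladder_reverse:
  assumes "ladder A b0 b1 c s"
  shows "ladder A b1 b0 (\<lambda>k. c (- k)) (\<lambda>k. s (1 - k))"
  unfolding ladder_def
proof
  fix j
  have 1: "quad A b0 b1 (c (- j)) (c (- (j + 1))) (s (j + 2)) (s (j + 1))"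
    using assms[unfolded ladder_def, rule_format, of "- (j + 1)"] by (simp add: algebra_simps)
  have 2: "quad A b0 b1 (c (- j + 1)) (c (- j)) (s (j + 1)) (s j)"
    using assms[unfolded ladder_def, rule_format, of "- j"] by (simp add: algebra_simps)
  have "quad A b1 b0 (c (- (j + 1))) (c (- j)) (s j) (s (j + 1))"
    using 2 by (intro quad_reverse[OF 1]) (simp_all add: quad_def col_commute)
  then show "quad A b1 b0 (c (- (j + 1))) (c (- j)) (s (1 - (1 - j))) (s (1 - - j))"
    by (simp add: add.commute)
qed

text \<open>The decisive use of uniqueness. Each configuration of the ladder determines a harmonic conjugate of \<open>b0\<close>
  with respect to \<open>A\<close> and \<open>b1\<close>, and all of them are the same point \<open>b2\<close>. So \<open>b2\<close> lies on all the lines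
  joining \<open>c (j + 1)\<close> to \<open>s (1 - j)\<close>, and \<open>b1, b2\<close> carry a ladder with the same \<open>c\<close> and with \<open>s\<close>
  shifted.\<close>

lemma ladder_next:
  assumes L: "ladder A b0 b1 c s"
  shows "\<exists>b2. ladder A b1 b2 c (\<lambda>k. s (k + 1))"
proof -
  have Q: "quad A b0 b1 (c (j + 1)) (c j) (s (1 - j)) (s (- j))" for j
    using L by (simp add: ladder_def)
  obtain b2 where b2: "\<And>j. col A b1 b2 \<and> col (c (j + 1)) (s (1 - j)) b2"
    using quad_conj_unique[of A b0 b1] Q by blast
  have "quad A b1 b2 (c (j + 1)) (c j) (s (2 - j)) (s (1 - j))" for j
  proof -
    note n = quad_noncol_all[OF Q[of j]]
    have i: "col b2 (s (1 - j)) (c (j + 1))" "col b2 (c j) (s (2 - j))"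
      using b2[of j] b2[of "j - 1"] by (simp_all add: col_commute algebra_simps)
    have ss: "col A (s (1 - j)) (s (2 - j))"
      using Q[of "j - 1"] by (simp add: quad_def col_commute algebra_simps)
    \<comment> \<open>if \<open>b2\<close> were \<open>A\<close>, then \<open>A\<close>, \<open>c (j + 1)\<close> and \<open>s (1 - j)\<close> would be collinear\<close>
    have "b2 \<noteq> A" using i n by (auto simp: col_commute)
    then have n1: "\<not> col A b2 (c j)" "\<not> col A b2 (s (1 - j))"
      using noncol_move[of A b1 "c j" b2] noncol_move[of A b1 "s (1 - j)" b2] b2 n Q[of j]
      by (simp_all add: quad_def col_commute)
    have "b2 \<noteq> b1" using i n by (auto simp: col_commute)
    then have "\<not> col b1 b2 (c j)"
      using noncol_move[of b1 A "c j" b2] b2 n by (simp add: col_commute)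
    then have "\<not> col (c j) (s (1 - j)) b2"
      using noncol_move[of "c j" b1 b2 "s (1 - j)"] Q[of j] quad_distinct[OF Q[of j]]
      by (simp add: quad_def col_commute)
    then show ?thesis
      using n1 n i ss b2 Q[of j] by (simp add: quad_def col_commute)
  qed
  then show ?thesis
    by (intro exI[of _ b2]) (simp add: ladder_def algebra_simps)
qed

lemma ladder_prev:
  assumes "ladder A b0 b1 c s"
  shows "\<exists>b'. ladder A b' b0 c (\<lambda>k. s (k - 1))"
proof -
  obtain b' where "ladder A b0 b' (\<lambda>k. c (- k)) (\<lambda>k. s (1 - (k + 1)))"
    using ladder_next[OF ladder_reverse[OF assms]] by blast
  from ladder_reverse[OF this] show ?thesis by (auto simp: algebra_simps)
qed

text \<open>Points on three lines through \<open>A\<close>, indexed so that \<open>b i\<close>, \<open>c j\<close>, \<open>s (i - j)\<close> are collinear. The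
  formulation by quadrangles also contains the incidences with \<open>A\<close> and all nondegeneracy
  conditions, and it makes exchanging the three lines, up to signs of the indices, a permutation
  of the vertices.\<close>

definition strip :: "'a \<Rightarrow> (int \<Rightarrow> 'a) \<Rightarrow> (int \<Rightarrow> 'a) \<Rightarrow> (int \<Rightarrow> 'a) \<Rightarrow> bool" where
  "strip A b c s \<longleftrightarrow> (\<forall>i j. quad A (b i) (b (i + 1)) (c (j + 1)) (c j) (s (i - j + 1)) (s (i - j)))"

lemma strip_exists:
  assumes "quad A b0 b1 c1 c0 s1 s0"
  shows "\<exists>b c s. strip A b c s \<and> b 0 = b0 \<and> b 1 = b1 \<and> c 0 = c0 \<and> c 1 = c1 \<and> s 0 = s0 \<and> s 1 = s1"
proof -
  obtain c s where cs: "ladder A b0 b1 c s" "c 0 = c0" "c 1 = c1" "s 0 = s0" "s 1 = s1"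
    using ladder_exists[OF assms] by blast
  define P where "P i = (\<lambda>(u, v). ladder A u v c (\<lambda>k. s (k + i)))" for i
  have "\<exists>f. f 0 = (b0, b1) \<and> (\<forall>i. P i (f i) \<and> snd (f i) = fst (f (i + 1)))"
  proof (rule two_sided_chain)
    show "P 0 (b0, b1)" using cs by (simp add: P_def)
    show "\<exists>y. P (i + 1) y \<and> snd x = fst y" if "P i x" for i x
      using ladder_next[of A "fst x" "snd x" c "\<lambda>k. s (k + i)"] that
      by (auto simp: P_def case_prod_beta algebra_simps)
    show "\<exists>x. P (i - 1) x \<and> snd x = fst y" if "P i y" for i y
      using ladder_prev[of A "fst y" "snd y" c "\<lambda>k. s (k + i)"] that
      by (auto simp: P_def case_prod_beta algebra_simps)
  qed
  then obtain f where f: "f 0 = (b0, b1)" "\<And>i. P i (f i)" "\<And>i. snd (f i) = fst (f (i + 1))" by blast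
  define b where "b i = fst (f i)" for i
  have "f i = (b i, b (i + 1))" for i
    using f(3) by (simp add: b_def prod_eq_iff)
  then have L: "ladder A (b i) (b (i + 1)) c (\<lambda>k. s (k + i))" for i
    using f(2)[of i] by (simp add: P_def)
  have "strip A b c s"
    using L unfolding strip_def ladder_def by (simp add: algebra_simps)
  moreover have "b 0 = b0" "b 1 = b1" using f(1) f(3)[of 0] by (simp_all add: b_def)
  ultimately show ?thesis using cs by blast
qed

lemma strip_swap_cs:
  assumes "strip A b c s" shows "strip A b s c"
  unfolding strip_def
proof (intro allI)
  fix i k
  show "quad A (b i) (b (i + 1)) (s (k + 1)) (s k) (c (i - k + 1)) (c (i - k))"
    using quad_swap_qs[OF assms[unfolded strip_def, rule_format, of i "i - k"]] by simp
qed

lemma strip_swap_bs: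
  assumes "strip A b c s" shows "strip A (\<lambda>i. s (- i)) c (\<lambda>i. b (- i))"
  unfolding strip_def
proof (intro allI)
  fix i j
  have "quad A (b (j - i - 1)) (b (j - i)) (c (j + 1)) (c j) (s (- i)) (s (- (i + 1)))"
    using assms[unfolded strip_def, rule_format, of "j - i - 1" j] by (simp add: algebra_simps)
  from quad_swap_zs[OF this]
  show "quad A (s (- i)) (s (- (i + 1))) (c (j + 1)) (c j) (b (- (i - j + 1))) (b (- (i - j)))"
    by (simp add: algebra_simps)
qed

lemma strip_quad:
  assumes "strip A b c s" shows "quad A (b i) (b (i + 1)) (c (j + 1)) (c j) (s (i - j + 1)) (s (i - j))"
  using assms by (simp add: strip_def)

lemma strip_col:
  assumes "strip A b c s" shows "col (b i) (c j) (s (i - j))"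
  using strip_quad[OF assms, of i j] by (simp add: quad_def col_commute)

lemma strip_noncol:
  assumes "strip A b c s"
  shows "\<not> col A (b i) (c j)" "\<not> col A (b i) (s j)" "\<not> col A (c i) (s j)"
  using quad_noncol_all[OF strip_quad[OF assms, of i j]]
    quad_noncol_all[OF strip_quad[OF assms, of i "i - j"]]
    quad_noncol_all[OF strip_quad[OF assms, of "i + j" i]] by (simp_all add: col_commute)

lemma strip_step:
  assumes "strip A b c s" shows "col A (b i) (b (i + 1))" "b i \<noteq> b (i + 1)" "A \<noteq> b i" "A \<in> ground M"
  using strip_quad[OF assms, of i 0] quad_distinct[OF strip_quad[OF assms, of i 0]]
    quad_ground[OF strip_quad[OF assms, of i 0]] by (simp_all add: quad_def col_commute)

lemma col_chain:
  fixes f :: "int \<Rightarrow> 'a"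
  assumes "\<And>i. col A (f i) (f (i + 1))" "\<And>i. A \<noteq> f i"
  shows "col A (f i) (f j)"
proof (induction j rule: int_induct[where k = i])
  case base
  show ?case using col_ground[OF assms(1)[of i]] by (simp add: col_triv)
next
  case (step1 j)
  have "col A (f j) (f i)" using step1(2) by (simp add: col_commute)
  then have "col A (f i) (f (j + 1))" using col_trans[OF _ assms(1)[of j] assms(2)[of j]] by blast
  then show ?case .
next
  case (step2 j)
  have "col A (f j) (f i)" "col A (f j) (f (j - 1))"
    using step2(2) assms(1)[of "j - 1"] by (simp_all add: col_commute)
  then show ?case using col_trans[of A "f j" "f i" "f (j - 1)"] assms(2)[of j] by blast
qed

lemma strip_line:
  assumes "strip A b c s" shows "col A (b i) (b j)"
  by (rule col_chain) (use strip_step[OF assms] in auto)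

text \<open>A conjugate sequence that can be run in both directions; it is determined by two consecutive
  points (\<open>conj_seq_unique\<close>).\<close>

definition conj_seq :: "'a \<Rightarrow> (int \<Rightarrow> 'a) \<Rightarrow> bool" where
  "conj_seq A f \<longleftrightarrow> (\<forall>i. harm_conj M A (f i) (f (i - 1)) (f (i + 1)) \<and>
      harm_conj M A (f i) (f (i + 1)) (f (i - 1)))"

lemma strip_conj_seq:
  assumes S: "strip A b c s" shows "conj_seq A b"
  unfolding conj_seq_def
proof (intro allI conjI)
  fix i
  have "quad A (b (i - 1)) (b i) (c 1) (c 0) (s i) (s (i - 1))"
    using strip_quad[OF S, of "i - 1" 0] by simp
  moreover have "col A (b i) (b (i + 1))" "col (c 1) (s i) (b (i + 1))"
    using strip_step(1)[OF S] strip_col[OF S, of "i + 1" 1] by (simp_all add: col_commute)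
  ultimately show "harm_conj M A (b i) (b (i - 1)) (b (i + 1))"
    unfolding harm_conj_iff by blast
next
  fix i
  have Q: "quad A (b i) (b (i + 1)) (c 0) (c (- 1)) (s (i + 1 + 1)) (s (i + 1))"
    using strip_quad[OF S, of i "- 1"] by simp
  have "quad A (b i) (b (i + 1)) (c 1) (c 0) (s (i + 1)) (s i)"
    using strip_quad[OF S, of i 0] by simp
  then have "quad A (b (i + 1)) (b i) (c (- 1)) (c 0) (s i) (s (i + 1))"
    by (intro quad_reverse[OF Q]) (simp_all add: quad_def col_commute)
  moreover have "col A (b i) (b (i - 1))" "col (c (- 1)) (s i) (b (i - 1))"
    using strip_step(1)[OF S, of "i - 1"] strip_col[OF S, of "i - 1" "- 1"]
    by (simp_all add: col_commute)
  ultimately show "harm_conj M A (b i) (b (i + 1)) (b (i - 1))"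
    unfolding harm_conj_iff by blast
qed

lemma conj_seq_reverse: "conj_seq A (\<lambda>i. f (- i)) \<Longrightarrow> conj_seq A f"
  unfolding conj_seq_def
proof (intro allI conjI)
  fix i
  assume a: "\<forall>i. harm_conj M A (f (- i)) (f (- (i - 1))) (f (- (i + 1))) \<and>
    harm_conj M A (f (- i)) (f (- (i + 1))) (f (- (i - 1)))"
  show "harm_conj M A (f i) (f (i - 1)) (f (i + 1))" "harm_conj M A (f i) (f (i + 1)) (f (i - 1))"
    using a[rule_format, of "- i"] by (simp_all add: add.commute)
qed

lemma strip_conj_seq_c:
  assumes "strip A b c s" shows "conj_seq A c"
  using strip_conj_seq[OF strip_swap_bs[OF strip_swap_cs[OF assms]]] by (rule conj_seq_reverse)

lemma strip_conj_seq_s: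
  assumes "strip A b c s" shows "conj_seq A s"
  using strip_conj_seq[OF strip_swap_bs[OF assms]] by (rule conj_seq_reverse)

lemma conj_seq_unique:
  assumes f: "conj_seq A f" and g: "conj_seq A g" and "f 0 = g 0" "f 1 = g 1"
  shows "f = g"
proof
  fix i
  have "f i = g i \<and> f (i + 1) = g (i + 1)"
  proof (induction i rule: int_induct[where k = 0])
    case base
    show ?case using assms by simp
  next
    case (step1 i)
    have "harm_conj M A (f (i + 1)) (f i) (f (i + 1 + 1))" "harm_conj M A (g (i + 1)) (g i) (g (i + 1 + 1))"
      using f[unfolded conj_seq_def, rule_format, of "i + 1"] g[unfolded conj_seq_def, rule_format, of "i + 1"]
      by simp_all
    then show ?case using step1 harm_conj_unique by auto
  next
    case (step2 i)
    have "harm_conj M A (f i) (f (i + 1)) (f (i - 1))" "harm_conj M A (g i) (g (i + 1)) (g (i - 1))"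
      using f[unfolded conj_seq_def, rule_format, of i] g[unfolded conj_seq_def, rule_format, of i]
      by simp_all
    then show ?case using step2 harm_conj_unique by auto
  qed
  then show "f i = g i" by simp
qed

text \<open>Both \<open>s (u - j)\<close> and \<open>s (v - j)\<close> are the intersection of the line through \<open>b u = b v\<close> and \<open>c j\<close> with the third line
  of the strip.\<close>

lemma strip_repeat:
  assumes S: "strip A b c s" and "b u = b v"
  shows "s (u - j) = s (v - j)"
proof (rule ccontr)
  assume ne: "s (u - j) \<noteq> s (v - j)"
  let ?x = "s (u - j)" and ?y = "s (v - j)"
  have "col A ?x ?y"
    using strip_line[OF strip_swap_bs[OF S], of "j - u" "j - v"] by simp
  moreover have "col (b u) (c j) ?x" "col (b u) (c j) ?y" "b u \<noteq> c j"
    using strip_col[OF S, of u j] strip_col[OF S, of v j] assms(2)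
      strip_noncol(1)[OF S, of u j] strip_step(4)[OF S] col_ground[OF strip_col[OF S, of u j]]
    by (auto simp: col_triv)
  then have "col (b u) ?x ?y" using col_trans[of "b u" "c j" ?x ?y] by simp
  ultimately have "col A ?x (b u)"
    using col_trans[of ?x ?y A "b u"] ne by (simp add: col_commute)
  then show False using strip_noncol(2)[OF S, of u "u - j"] by (simp add: col_commute)
qed

text \<open>A single repetition in \<open>b\<close> gives one at every index of \<open>c\<close> and \<open>s\<close>, and these carry over to \<open>b\<close>.\<close>

lemma strip_period:
  assumes S: "strip A b c s" and "b u = b v"
  shows "b (i + (u - v)) = b i" "c (i + (u - v)) = c i"
proof -
  show "c (i + (u - v)) = c i"
    using strip_repeat[OF strip_swap_cs[OF S] assms(2), of "v - i"] by (simp add: algebra_simps)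
  have "s u = s v" using strip_repeat[OF S assms(2), of 0] by simp
  then have "b (- (- v - j)) = b (- (- u - j))" for j
    using strip_repeat[OF strip_swap_bs[OF S], of "- v" "- u"] by simp
  from this[of "i - v"] show "b (i + (u - v)) = b i" by (simp add: algebra_simps)
qed

end

section \<open>The plane spanned by a strip\<close>

context harmonic_matroid begin

text \<open>Column \<open>i\<close> and column \<open>i + 1\<close>, together with the line at infinity, are three lines through \<open>s0\<close>, and the unit square
  with sides on the rows \<open>0\<close> and \<open>1\<close> starts a strip on them. Adjacent strips agree on the common column, and
  all of them agree at infinity, because conjugate sequences are determined by two of
  their points. The sign in \<open>D (- m)\<close> turns the index rule of a strip into slopes.\<close>

lemma plane_exists:
  assumes "quad d b0 b1 c1 c0 s1 s0"
  shows "\<exists>P D c s. strip d (\<lambda>i. P i 0) c s \<and> P 0 0 = b0 \<and> P 1 0 = b1 \<and> D 0 = d \<and>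
    (\<forall>i. P i 1 = c i) \<and> (\<forall>i. strip s0 (P i) (P (i + 1)) (\<lambda>m. D (- m)))"
proof -
  obtain b c s where S: "strip d b c s" "b 0 = b0" "b 1 = b1" "s 0 = s0" "s 1 = s1"
    using strip_exists[OF assms] by blast
  \<comment> \<open>the vertices \<open>d, b (i + 1), c i, s0\<close> are the same as in the strip of rows \<open>0\<close> and \<open>1\<close>, with \<open>d\<close> and \<open>s0\<close> exchanged\<close>
  have Q: "quad s0 (b i) (c i) (c (i + 1)) (b (i + 1)) s1 d" for i
    using strip_quad[OF S(1), of i i] quad_noncol_all[OF strip_quad[OF S(1), of i i]] S(4,5)
    by (simp add: quad_def col_commute)
  have "\<forall>i. \<exists>f g h. strip s0 f g h \<and> f 0 = b i \<and> f 1 = c i \<and>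
      g 0 = b (i + 1) \<and> g 1 = c (i + 1) \<and> h 0 = d \<and> h 1 = s1"
    using strip_exists[OF Q] by simp
  then obtain P G H where PGH: "\<And>i. strip s0 (P i) (G i) (H i)" "\<And>i. P i 0 = b i" "\<And>i. P i 1 = c i"
     "\<And>i. G i 0 = b (i + 1)" "\<And>i. G i 1 = c (i + 1)" "\<And>i. H i 0 = d" "\<And>i. H i 1 = s1"
    unfolding choice_iff by blast
  have G: "G i = P (i + 1)" for i
    using strip_conj_seq_c[OF PGH(1)[of i]] strip_conj_seq[OF PGH(1)[of "i + 1"]]
    by (rule conj_seq_unique) (simp_all add: PGH)
  have H: "H i = H 0" for i
    using strip_conj_seq_s[OF PGH(1)[of i]] strip_conj_seq_s[OF PGH(1)[of 0]]
    by (rule conj_seq_unique) (simp_all add: PGH)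
  define D where "D m = H 0 (- m)" for m
  show ?thesis
  proof (intro exI conjI allI)
    show "strip s0 (P i) (P (i + 1)) (\<lambda>m. D (- m))" for i
      using PGH(1)[of i] G[of i] H[of i] by (simp add: D_def)
    show "strip d (\<lambda>i. P i 0) c s" using S PGH by simp
  qed (use S PGH in \<open>simp_all add: D_def\<close>)
qed

end

text \<open>The points \<open>P i j\<close>, the vertical direction \<open>V\<close> and the directions \<open>D m\<close> of slope \<open>m\<close>, where row \<open>0\<close> has
  exact period \<open>p\<close>. Consequences of these assumptions are that \<open>p\<close> is prime and that the coordinates may be read
  modulo \<open>p\<close>.\<close>

locale coordinate_plane = harmonic_matroid +
  fixes P :: "int \<Rightarrow> int \<Rightarrow> 'a" and D :: "int \<Rightarrow> 'a" and V :: 'a and p :: int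
  assumes p_pos: "p > 0"
    and strips: "strip V (P i) (P (i + 1)) (\<lambda>m. D (- m))"
    and period: "P (i + p) = P i"
    and row_inj: "P i 0 = P j 0 \<Longrightarrow> p dvd i - j"
begin

lemma col_P_D: "col V (P i j) (P i k)" "col V (D m) (D l)"
  using strip_line[OF strips] strip_line[OF strip_swap_bs[OF strips[of i]], of m l] by simp_all

lemma noncol_P_D: "\<not> col V (P i j) (D m)"
  using strip_noncol(2)[OF strips[of i], of j "- m"] by simp

lemma grounds: "V \<in> ground M" "P i j \<in> ground M" "D m \<in> ground M"
  using col_ground[OF col_P_D(1)] col_ground[OF col_P_D(2)] by blast+

lemma P_neq_D: "P i j \<noteq> D m" "V \<noteq> P i j" "V \<noteq> D m"
  using noncol_P_D[of i j m] grounds by (auto simp: col_triv)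

lemma slope_line: "col (D m) (P i j) (P (i + k) (j + m * k))"
proof -
  have "col (D m) (P (i + k) (j + m * k)) (P (i + (k + 1)) (j + m * (k + 1)))" for k
    using strip_col[OF strips[of "i + k"], of "j + m * k" "j + m * (k + 1)"]
    by (simp add: algebra_simps col_commute)
  moreover have "D m \<noteq> P (i + k) (j + m * k)" for k
    using P_neq_D(1) by metis
  ultimately have "col (D m) (P (i + 0) (j + m * 0)) (P (i + k) (j + m * k))"
    by (rule col_chain[where f = "\<lambda>k. P (i + k) (j + m * k)"])
  then show ?thesis by simp
qed

lemma slope_unique:
  assumes "col (P i j) x (D m)" "col (P i j) x (D l)" "P i j \<noteq> x"
  shows "D m = D l"
proof (rule ccontr)
  assume ne: "D m \<noteq> D l"
  have "col (P i j) (D m) (D l)" using col_trans[OF assms] .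
  then have "col (D m) (P i j) V"
    using col_trans[of "D m" "D l" "P i j" V] col_P_D(2)[of m l] ne by (simp add: col_commute)
  then show False using noncol_P_D by (simp add: col_commute)
qed

lemma column_neq:
  assumes "\<not> p dvd i - i'"
  shows "\<not> col V (P i j) (P i' j')"
proof
  assume a: "col V (P i j) (P i' j')"
  have "col V (P i j) (P i' 0)"
    using col_trans[of V "P i' j'" "P i j" "P i' 0"] a col_P_D(1) P_neq_D by (simp add: col_commute)
  then have "col V (P i 0) (P i' 0)"
    using col_trans[of V "P i j" "P i' 0" "P i 0"] col_P_D(1) P_neq_D by (simp add: col_commute)
  moreover have "col (D 0) (P i 0) (P i' 0)" using slope_line[of 0 i 0 "i' - i"] by simp
  ultimately have "col (P i 0) V (D 0)"
    using assms row_inj col_trans[of "P i 0" "P i' 0" V "D 0"] by (auto simp: col_commute)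
  then show False using noncol_P_D by (simp add: col_commute)
qed

text \<open>The line of slope \<open>1\<close> through \<open>P i j\<close> contains \<open>P (i + p) (j + p) = P i (j + p)\<close>, which also lies in
  column \<open>i\<close>.\<close>

lemma period_column: "P i (j + p) = P i j"
proof (rule ccontr)
  assume "P i (j + p) \<noteq> P i j"
  moreover have "col (P i j) (P i (j + p)) (D 1)"
    using slope_line[of 1 i j p] period by (simp add: col_commute)
  moreover have "col (P i j) (P i (j + p)) V" using col_P_D(1) by (simp add: col_commute)
  ultimately have "col (P i j) (D 1) V"
    using col_trans[of "P i j" "P i (j + p)" "D 1" V] by metis
  then show False using noncol_P_D by (simp add: col_commute)
qed

lemma P_cong: "p dvd i - i' \<Longrightarrow> p dvd j - j' \<Longrightarrow> P i j = P i' j'"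
  using periodic_eq_of_dvd[of P p i i', OF period] periodic_eq_of_dvd[of "P i'" p j j', OF period_column] by simp

lemma D_cong:
  assumes "p dvd m - l" shows "D m = D l"
proof (rule slope_unique[of 0 0 "P 1 m"])
  show "col (P 0 0) (P 1 m) (D m)" using slope_line[of m 0 0 1] by (simp add: col_commute)
  have "P 1 m = P 1 l" using assms by (intro P_cong) auto
  then show "col (P 0 0) (P 1 m) (D l)" using slope_line[of l 0 0 1] by (simp add: col_commute)
  show "P 0 0 \<noteq> P 1 m" using strip_noncol(1)[OF strips[of 0], of 0 m] grounds by (auto simp: col_triv)
qed

lemma slope_line_cong:
  assumes "p dvd j' - j - m * (i' - i)"
  shows "col (D m) (P i j) (P i' j')"
proof -
  have "P i' j' = P (i + (i' - i)) (j + m * (i' - i))"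
    using assms by (intro P_cong) (auto simp: algebra_simps)
  then show ?thesis using slope_line[of m i j "i' - i"] by simp
qed

text \<open>If slopes \<open>m\<close> and \<open>0\<close> coincide, then every column has period \<open>m\<close>. So the line of slope \<open>1\<close>
  through \<open>P 0 0\<close> contains \<open>P m m = P m 0\<close>; unless this is the point \<open>P 0 0\<close>, slope \<open>1\<close> would equal
  slope \<open>0\<close>, but consecutive directions of a strip are distinct.\<close>

lemma D_eq_imp_dvd:
  assumes "D m = D 0" shows "p dvd m"
proof (rule ccontr)
  assume n: "\<not> p dvd m"
  have P: "P i m = P i 0" for i
  proof (rule ccontr)
    assume ne: "P i m \<noteq> P i 0"
    have "col (D 0) (P (i - 1) 0) (P i m)" "col (D 0) (P (i - 1) 0) (P i 0)"
      using slope_line[of m "i - 1" 0 1] slope_line[of 0 "i - 1" 0 1] assms by simp_all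
    then have "col (D 0) (P i m) (P i 0)"
      using P_neq_D(1)[of "i - 1" 0 0] col_trans[of "D 0" "P (i - 1) 0" "P i m" "P i 0"] by metis
    moreover have "col V (P i m) (P i 0)" by (rule col_P_D)
    ultimately have "col (P i 0) (D 0) V"
      using ne col_trans[of "P i 0" "P i m" "D 0" V] by (auto simp: col_commute)
    then show False using noncol_P_D by (simp add: col_commute)
  qed
  have "D 1 = D 0"
  proof (rule slope_unique[of 0 0 "P m 0"])
    show "col (P 0 0) (P m 0) (D 1)" using slope_line[of 1 0 0 m] P by (simp add: col_commute)
    show "col (P 0 0) (P m 0) (D 0)" using slope_line[of 0 0 0 m] by (simp add: col_commute)
    show "P 0 0 \<noteq> P m 0" using row_inj[of m 0] n by auto
  qed
  then show False using strip_step(2)[OF strip_swap_bs[OF strips[of 0]], of 0] by simp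
qed

text \<open>If \<open>p\<close> does not divide \<open>k\<close>, then \<open>P k (m * k) = P k 0\<close> is a point of row \<open>0\<close> other than \<open>P 0 0\<close>, and it
  lies on the line of slope \<open>m\<close> through \<open>P 0 0\<close>. So slope \<open>m\<close> is slope \<open>0\<close>.\<close>

lemma period_prime:
  assumes "p dvd m * k" shows "p dvd m \<or> p dvd k"
proof (rule ccontr)
  assume n: "\<not> (p dvd m \<or> p dvd k)"
  have "D m = D 0"
  proof (rule slope_unique[of 0 0 "P k 0"])
    show "col (P 0 0) (P k 0) (D m)"
      using slope_line_cong[of 0 0 m k 0] assms by (simp add: col_commute)
    show "col (P 0 0) (P k 0) (D 0)" using slope_line[of 0 0 0 k] by (simp add: col_commute)
    show "P 0 0 \<noteq> P k 0" using row_inj[of k 0] n by auto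
  qed
  then show False using D_eq_imp_dvd n by blast
qed

lemma period_inverse:
  assumes "\<not> p dvd a" obtains t where "p dvd c - a * t"
proof -
  \<comment> \<open>as \<open>p\<close> is prime and does not divide \<open>a\<close>, the two are coprime\<close>
  obtain h where h: "p = gcd a p * h" by (meson dvdE gcd_dvd2)
  then have "p dvd gcd a p * h" by simp
  then have "p dvd gcd a p \<or> p dvd h" by (rule period_prime)
  then have "p dvd h" using assms by auto
  then obtain h' where h': "h = p * h'" by (rule dvdE)
  have "p * (gcd a p * h') = p * 1" using h h' by (simp add: ac_simps)
  then have "gcd a p * h' = 1" using p_pos by simp
  then have "gcd a p = 1" by (metis gcd_pos_int p_pos less_irrefl pos_zmult_eq_1_iff)
  then obtain u v where uv: "u * a + v * p = 1" using bezout_int[of a p] by metis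
  have "c - a * (u * c) = c * (u * a + v * p) - a * (u * c)" using uv by simp
  also have "\<dots> = p * (v * c)" by (simp add: algebra_simps)
  finally show thesis using that[of "u * c"] by simp
qed

definition row :: "'a set" where "row = insert (D 0) (range (\<lambda>i. P i 0))"

lemma row_col: "x \<in> row \<Longrightarrow> y \<in> row \<Longrightarrow> z \<in> row \<Longrightarrow> col x y z"
proof -
  have a: "col (D 0) (P 0 0) x" if "x \<in> row" for x
    using that slope_line[of 0 0 0] grounds by (auto simp: row_def col_triv)
  assume "x \<in> row" "y \<in> row" "z \<in> row"
  then have "col (D 0) (P 0 0) x" "col (D 0) (P 0 0) y" "col (D 0) (P 0 0) z" using a by auto
  then show "col x y z" using col_of_common_line[of "D 0" "P 0 0" x y z] P_neq_D(1)[of 0 0 0] by metis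
qed

lemma line_meets_row: "\<exists>w\<in>row. col (P i j) (D m) w"
proof (cases "p dvd m")
  case True
  then have "D m = D 0" by (intro D_cong) simp
  then show ?thesis using grounds by (intro bexI[of _ "D 0"]) (auto simp: row_def col_triv)
next
  case False
  then obtain t where "p dvd - j - m * t" by (rule period_inverse)
  then have "col (D m) (P i j) (P (i + t) 0)"
    by (intro slope_line_cong) simp
  then show ?thesis by (intro bexI[of _ "P (i + t) 0"]) (auto simp: row_def col_commute)
qed

text \<open>Reduces closure of the row to exhibiting a quadrangle in coordinates: its diagonal \<open>p r\<close> has some
  slope \<open>m\<close>, and every line with a slope meets the row.\<close>

lemma harm_conj_in_row:
  assumes Q: "quad y x z (P i j) q r s" and "y \<in> row" "z \<in> row" "col (P i j) r (D m)"
  shows "\<exists>w\<in>row. harm_conj M y z x w"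
proof -
  obtain w where w: "w \<in> row" "col (P i j) (D m) w" using line_meets_row by blast
  have "col (P i j) r w"
    using col_trans[of "P i j" "D m" r w] w assms(4) P_neq_D by (simp add: col_commute)
  then show ?thesis using w Q row_col assms unfolding harm_conj_iff by blast
qed

text \<open>The line \<open>y z\<close> is the row, which meets column \<open>i\<close> only in \<open>P i 0\<close>. If that point equalled \<open>P i j\<close>, then the
  line from \<open>P (i - 1) 0\<close> to it would have slopes \<open>j\<close> and \<open>0\<close>.\<close>

lemma row_noncol:
  assumes "y \<in> row" "z \<in> row" "y \<noteq> z" "\<not> p dvd j"
  shows "\<not> col y z (P i j)"
proof
  assume a: "col y z (P i j)"
  have "col y z (P i 0)" "col y z (D 0)" using assms by (auto intro!: row_col simp: row_def)
  then have c: "col (P i j) (P i 0) (D 0)" using a assms(3) col_of_common_line[of y z] by blast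
  have "P i j = P i 0"
  proof (rule ccontr)
    assume "P i j \<noteq> P i 0"
    then have "col (P i j) (D 0) V"
      using col_trans[OF c, of V] col_P_D(1) by (simp add: col_commute)
    then show False using noncol_P_D by (simp add: col_commute)
  qed
  then have "col (P (i - 1) 0) (P i j) (D j)" "col (P (i - 1) 0) (P i j) (D 0)"
    using slope_line[of j "i - 1" 0 1] slope_line[of 0 "i - 1" 0 1] by (simp_all add: col_commute)
  moreover have "P (i - 1) 0 \<noteq> P i j"
    using strip_noncol(1)[OF strips[of "i - 1"], of 0 j] grounds by (auto simp: col_triv)
  ultimately have "D j = D 0" by (rule slope_unique)
  then show False using D_eq_imp_dvd assms(4) by blast
qed

text \<open>The vertices are \<open>D 0\<close>, \<open>(i, 0)\<close>, \<open>(j, 1)\<close> and \<open>V\<close>, where \<open>m\<close> is the slope from \<open>(i, 0)\<close> to \<open>(j, 1)\<close>. The diagonal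
  point \<open>r\<close> is itself the direction \<open>D m\<close>.\<close>

lemma row_conj_at_infinity:
  assumes "\<not> p dvd j - i"
  shows "\<exists>w\<in>row. harm_conj M (D 0) (P i 0) (P j 0) w"
proof -
  obtain m where m: "p dvd 1 - (j - i) * m" using assms by (rule period_inverse)
  have one: "\<not> p dvd 1" using assms by (meson dvd_trans one_dvd)
  have "quad (D 0) (P j 0) (P i 0) (P i 1) (P j 1) (D m) V"
    unfolding quad_def
  proof (intro conjI)
    show "\<not> col (D 0) (P i 0) (P j 1)"
      using one P_neq_D(1)[of i 0 0] by (intro row_noncol) (auto simp: row_def)
    show "\<not> col (D 0) (P i 0) V" "\<not> col (D 0) (P j 1) V" using noncol_P_D by (simp_all add: col_commute)
    show "\<not> col (P i 0) (P j 1) V" using column_neq[OF assms] by (simp add: col_commute)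
    show "col (D 0) (P i 0) (P j 0)" by (intro row_col) (auto simp: row_def)
    show "col (P j 1) V (P j 0)" "col (P i 0) V (P i 1)" "col (D 0) V (D m)"
      using col_P_D by (simp_all add: col_commute)
    show "col (D 0) (P j 1) (P i 1)" by (intro slope_line_cong) simp
    have "col (D m) (P i 0) (P j 1)" using m by (intro slope_line_cong) (simp add: mult.commute)
    then show "col (P i 0) (P j 1) (D m)" by (simp add: col_commute)
  qed
  moreover have "col (P i 1) (D m) (D m)" using grounds by (simp add: col_triv)
  ultimately show ?thesis by (intro harm_conj_in_row) (auto simp: row_def)
qed

text \<open>The vertices are \<open>(i, 0)\<close>, \<open>(j, 0)\<close>, \<open>D 1\<close> and \<open>V\<close>. The diagonal points other than \<open>D 0\<close> are joined by a line of
  slope \<open>2\<close>; this meets the row in the midpoint of \<open>(i, 0)\<close> and \<open>(j, 0)\<close>, or in \<open>D 0\<close> when \<open>p = 2\<close>.\<close>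

lemma row_conj_of_infinity:
  assumes "\<not> p dvd i - j"
  shows "\<exists>w\<in>row. harm_conj M (P i 0) (P j 0) (D 0) w"
proof -
  have one: "\<not> p dvd 1" using assms by (meson dvd_trans one_dvd)
  have D1: "D 1 \<noteq> D 0" using D_eq_imp_dvd[of 1] one by blast
  have "quad (P i 0) (D 0) (P j 0) (P j (j - i)) (D 1) (P i (i - j)) V"
    unfolding quad_def
  proof (intro conjI)
    have "col (P i 0) (P j 0) (D 0)" by (intro row_col) (auto simp: row_def)
    moreover have "P i 0 \<noteq> P j 0" using column_neq[OF assms, of 0 0] grounds by (auto simp: col_triv)
    ultimately show "\<not> col (P i 0) (P j 0) (D 1)" using slope_unique D1 by blast
    show "\<not> col (P i 0) (P j 0) V" using column_neq[OF assms] by (simp add: col_commute)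
    show "\<not> col (P i 0) (D 1) V" "\<not> col (P j 0) (D 1) V" using noncol_P_D by (simp_all add: col_commute)
    show "col (P i 0) (P j 0) (D 0)" by fact
    show "col (D 1) V (D 0)" "col (P j 0) V (P j (j - i))" "col (P i 0) V (P i (i - j))"
      using col_P_D by (simp_all add: col_commute)
    show "col (P i 0) (D 1) (P j (j - i))" "col (P j 0) (D 1) (P i (i - j))"
      using slope_line_cong[of "j - i" 0 1 j i] slope_line_cong[of "i - j" 0 1 i j] by (simp_all add: col_commute)
  qed
  moreover have "col (D 2) (P j (j - i)) (P i (i - j))" by (intro slope_line_cong) simp
  then have "col (P j (j - i)) (P i (i - j)) (D 2)" by (simp add: col_commute)
  ultimately show ?thesis by (intro harm_conj_in_row) (auto simp: row_def)
qed

text \<open>The vertices are \<open>(i, 0)\<close>, \<open>(j, 0)\<close>, \<open>(k, k - i)\<close> and \<open>V\<close>. The third one is chosen such that its line to the first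
  has slope \<open>1\<close>; its line to the second has slope \<open>m = (k - i) / (k - j)\<close>. The two remaining diagonal points
  \<open>(j, j - i)\<close> and \<open>(i, (i - j) m)\<close> are joined by a line of slope \<open>m + 1\<close>.\<close>

lemma row_conj_finite:
  assumes ij: "\<not> p dvd i - j" and jk: "\<not> p dvd k - j" and ik: "\<not> p dvd k - i"
  shows "\<exists>w\<in>row. harm_conj M (P i 0) (P j 0) (P k 0) w"
proof -
  obtain m where m: "p dvd (k - i) - (k - j) * m" using jk by (rule period_inverse)
  have ne: "P i 0 \<noteq> P j 0" using column_neq[OF ij, of 0 0] grounds by (auto simp: col_triv)
  have "quad (P i 0) (P k 0) (P j 0) (P j (j - i)) (P k (k - i)) (P i ((i - j) * m)) V"
    unfolding quad_def
  proof (intro conjI)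
    show "\<not> col (P i 0) (P j 0) (P k (k - i))" using ik ne by (intro row_noncol) (auto simp: row_def)
    show "\<not> col (P i 0) (P j 0) V" "\<not> col (P i 0) (P k (k - i)) V" "\<not> col (P j 0) (P k (k - i)) V"
      using column_neq[OF ij, of 0 0] column_neq[OF ik, of "k - i" 0] column_neq[OF jk, of "k - i" 0]
      by (simp_all add: col_commute)
    show "col (P i 0) (P j 0) (P k 0)" by (intro row_col) (auto simp: row_def)
    show "col (P k (k - i)) V (P k 0)" "col (P j 0) V (P j (j - i))" "col (P i 0) V (P i ((i - j) * m))"
      using col_P_D by (simp_all add: col_commute)
    have "col (D 1) (P i 0) (P k (k - i))" "col (D 1) (P i 0) (P j (j - i))"
      by (intro slope_line_cong; simp)+
    then show "col (P i 0) (P k (k - i)) (P j (j - i))"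
      using col_trans[of "P i 0" "D 1" "P k (k - i)" "P j (j - i)"] P_neq_D by (simp add: col_commute)
    have "col (D m) (P j 0) (P k (k - i))" "col (D m) (P j 0) (P i ((i - j) * m))"
      using m by (intro slope_line_cong; simp add: mult.commute)+
    then show "col (P j 0) (P k (k - i)) (P i ((i - j) * m))"
      using col_trans[of "P j 0" "D m" "P k (k - i)" "P i ((i - j) * m)"] P_neq_D by (simp add: col_commute)
  qed
  moreover have "col (D (m + 1)) (P j (j - i)) (P i ((i - j) * m))"
    by (intro slope_line_cong) (simp add: algebra_simps)
  then have "col (P j (j - i)) (P i ((i - j) * m)) (D (m + 1))" by (simp add: col_commute)
  ultimately show ?thesis by (intro harm_conj_in_row) (auto simp: row_def)
qed

text \<open>The conjugate depends only on \<open>x, y, z\<close>, so it is the one computed in the coordinate plane.\<close>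

lemma row_closed:
  assumes "x \<in> row" "y \<in> row" "z \<in> row" "harm_conj M y z x v"
  shows "v \<in> row"
proof -
  have d: "y \<noteq> z" "x \<noteq> y" "x \<noteq> z"
    using assms(4) quad_distinct unfolding harm_conj_iff by fastforce+
  have P: "\<not> p dvd i - j" if "P i 0 \<noteq> P j 0" for i j
    using that P_cong[of i j 0 0] by auto
  consider i j where "y = D 0" "z = P i 0" "x = P j 0" | i j where "z = D 0" "y = P i 0" "x = P j 0"
    | i j where "x = D 0" "y = P i 0" "z = P j 0" | i j k where "y = P i 0" "z = P j 0" "x = P k 0"
    using assms(1-3) d unfolding row_def by blast
  then have "\<exists>w\<in>row. harm_conj M y z x w"
  proof cases
    case (1 i j)
    then show ?thesis using row_conj_at_infinity[of j i] P[of j i] d by simp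
  next
    case (2 i j)
    then show ?thesis using row_conj_at_infinity[of j i] P[of j i] d harm_conj_sym[of "D 0"] by simp
  next
    case (3 i j)
    then show ?thesis using row_conj_of_infinity[of i j] P[of i j] d by simp
  next
    case (4 i j k)
    then show ?thesis using row_conj_finite[of i j k] P[of i j] P[of k j] P[of k i] d by simp
  qed
  then show ?thesis using harm_conj_unique[OF assms(4)] by blast
qed

end

section \<open>Modular sequences are nets\<close>

context harmonic_matroid begin

lemma strip_eq_iff_dvd:
  assumes S: "strip A b c s" and "0 < p" "b (int p) = b 0" and inj: "inj_on (\<lambda>i. b (int i)) {..<p}"
  shows "b u = b v \<longleftrightarrow> int p dvd u - v"
proof -
  have "b (i + int p) = b i" for i using strip_period(1)[OF S assms(3), of i] by simp
  then have b: "b x = b (int (nat (x mod int p)))" for x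
    by (rule periodic_eq_of_dvd[of b "int p"]) (use assms(2) in \<open>simp add: minus_mod_eq_mult_div\<close>)
  show ?thesis
  proof
    assume "b u = b v"
    then have "nat (u mod int p) = nat (v mod int p)"
      using b[of u] b[of v] inj_onD[OF inj, of "nat (u mod int p)" "nat (v mod int p)"] assms(2)
      by (simp add: nat_less_iff)
    then have "u mod int p = v mod int p" using assms(2) by (simp add: eq_nat_nat_iff)
    then show "int p dvd u - v" by (simp add: mod_eq_dvd_iff)
  next
    assume "int p dvd u - v"
    then have "u mod int p = v mod int p" by (simp add: mod_eq_dvd_iff)
    then show "b u = b v" using b[of u] b[of v] by simp
  qed
qed

lemma strip_line_harm_closed:
  assumes S: "strip d b c s"
    and p: "0 < p" "b (int p) = b 0" "inj_on (\<lambda>i. b (int i)) {..<p}"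
    and h: "harm_conj M y z x v" "{x, y, z} \<subseteq> insert d (range b)"
  shows "v \<in> insert d (range b)"
proof -
  have "quad d (b 0) (b 1) (c 1) (c 0) (s 1) (s 0)" using strip_quad[OF S, of 0 0] by simp
  from plane_exists[OF this]
  obtain P D c' s' where "strip d (\<lambda>i. P i 0) c' s' \<and> P 0 0 = b 0 \<and> P 1 0 = b 1 \<and> D 0 = d \<and>
    (\<forall>i. P i 1 = c' i) \<and> (\<forall>i. strip (s 0) (P i) (P (i + 1)) (\<lambda>m. D (- m)))"
    by (elim exE) (rule that)
  then have S': "strip d (\<lambda>i. P i 0) c' s'" "P 0 0 = b 0" "P 1 0 = b 1" "D 0 = d" "\<And>i. P i 1 = c' i"
    "\<And>i. strip (s 0) (P i) (P (i + 1)) (\<lambda>m. D (- m))"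
    by simp_all
  have b: "P i 0 = b i" for i
    using conj_seq_unique[OF strip_conj_seq[OF S'(1)] strip_conj_seq[OF S]] S'(2,3)
    by (simp add: fun_eq_iff)
  interpret coordinate_plane M P D "s 0" "int p"
  proof
    show "0 < int p" using p by simp
    show "strip (s 0) (P i) (P (i + 1)) (\<lambda>m. D (- m))" for i by fact
    show "P (i + int p) = P i" for i
    proof (rule conj_seq_unique[OF strip_conj_seq[OF S'(6)] strip_conj_seq[OF S'(6)]])
      show "P (i + int p) 0 = P i 0"
        using strip_period(1)[OF S p(2), of i] by (simp add: b)
      show "P (i + int p) 1 = P i 1"
        using strip_period(2)[OF S'(1), of "int p" 0 i] p(2) S'(5) by (simp add: b)
    qed
    show "int p dvd i - j" if "P i 0 = P j 0" for i j
      using that strip_eq_iff_dvd[OF S p] by (simp add: b)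
  qed
  have "row = insert d (range b)" using S' by (simp add: row_def b)
  then show ?thesis using row_closed[of x y z v] h by simp
qed

lemma moebius_net_of_closed:
  assumes "set xs \<subseteq> ground M" "a \<in> ground M" "a' \<in> ground M" "set xs \<subseteq> cl M {a, a'}"
    and closed: "\<And>x y z v. {x, y, z} \<subseteq> set xs \<Longrightarrow> harm_conj M y z x v \<Longrightarrow> v \<in> set xs"
  shows "moebius_harmonic_net M xs"
proof -
  have "mrank M (set xs) \<le> enat (card {a, a'})"
    using assms(2-4) by (intro mrank_le_card_spanning) auto
  also have "\<dots> \<le> 2" by (cases "a = a'") (simp_all add: numeral_eq_enat one_enat_def)
  finally have "collinear_in M (set xs)" by (simp add: collinear_in_def)
  moreover have step: "harm_step M (set xs) = set xs"
    unfolding harm_step_def using closed by blast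
  have "(harm_step M ^^ k) (set xs) = set xs" for k
    by (induction k) (simp_all add: step)
  then have "harm_closure M (set xs) = set xs" by (simp add: harm_closure_def)
  ultimately show ?thesis using assms(1) by (simp add: moebius_harmonic_net_def)
qed

text \<open>One relation \<open>H(d, b 1; b 0, b 2)\<close> provides a configuration, hence a strip, whose first line continues
  the sequence. The first repetition must be of \<open>b 0\<close>, as a repetition of \<open>b j\<close> with \<open>j > 0\<close> could be shifted back by
  \<open>j\<close> steps to an earlier one. For \<open>n = 0\<close> no such relation is available.\<close>

lemma modular_sequence_in_strip:
  assumes "modular_sequence M d b (n + 1)" "n > 0"
  shows "\<exists>f c s. strip d f c s \<and> (\<forall>i\<le>n. b i = f (int i)) \<and> f (int (n + 1)) = f 0 \<and>
    inj_on (\<lambda>i. f (int i)) {..<n + 1}"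
proof -
  obtain N where N: "conjugate_sequence M d b N" "enat (n + 1) < N" "repeats_at d b (n + 1)"
    "\<And>k. k < n + 1 \<Longrightarrow> \<not> repeats_at d b k"
    using assms(1) unfolding modular_sequence_def by blast
  have le: "enat k < N" if "k \<le> n + 1" for k
    using le_less_trans[OF _ N(2), of "enat k"] that by simp
  have h: "harm_conj M d (b (Suc i)) (b i) (b (Suc (Suc i)))" if "i < n" for i
  proof -
    have "harm_conj M d (b (Suc i)) (b (Suc i - 1)) (b (Suc i + 1))"
      using N(1) le[of "Suc i + 1"] that unfolding conjugate_sequence_def by (auto simp del: diff_Suc_1)
    then show ?thesis by simp
  qed
  obtain c1 c0 s1 s0 where Q: "quad d (b 0) (b 1) c1 c0 s1 s0"
    using h[of 0] assms(2) unfolding harm_conj_iff by auto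
  obtain f c s where S: "strip d f c s" "f 0 = b 0" "f 1 = b 1" using strip_exists[OF Q] by blast
  have f: "i \<le> n \<Longrightarrow> b i = f (int i) \<and> b (Suc i) = f (int (Suc i))" for i
  proof (induction i)
    case (Suc i)
    have "harm_conj M d (f (int (Suc i))) (f (int i)) (f (int (Suc (Suc i))))"
      using strip_conj_seq[OF S(1), unfolded conj_seq_def, rule_format, of "int (Suc i)"]
      by (simp add: algebra_simps)
    moreover have "harm_conj M d (f (int (Suc i))) (f (int i)) (b (Suc (Suc i)))"
      using Suc h[of i] by simp
    ultimately have "b (Suc (Suc i)) = f (int (Suc (Suc i)))"
      using harm_conj_unique by blast
    then show ?case using Suc by simp
  qed (use S in simp)
  have inj_b: "b i \<noteq> b j" if "i < j" "j \<le> n" for i j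
  proof -
    have "b i \<in> b ` {..<j}" using that by simp
    moreover have "b j \<notin> b ` {..<j}" using N(4)[of j] that by (simp add: repeats_at_def)
    ultimately show ?thesis by metis
  qed
  have inj: "inj_on b {..n}"
  proof (rule inj_onI, rule ccontr)
    fix i j assume "i \<in> {..n}" "j \<in> {..n}" "b i = b j" "i \<noteq> j"
    then show False using inj_b[of i j] inj_b[of j i] by (cases i j rule: linorder_cases) auto
  qed
  then have "inj_on (\<lambda>i. f (int i)) {..<n + 1}"
    using f by (simp add: inj_on_def lessThan_Suc_atMost)
  moreover have "f (int (n + 1)) = f 0"
  proof -
    \<comment> \<open>the strip never returns to its centre \<open>d\<close>, so the repeated point is some \<open>b j\<close>\<close>
    have "b (n + 1) \<noteq> d" using f[of n] strip_step(3)[OF S(1), of "int (n + 1)"] by auto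
    then have "b (n + 1) \<in> b ` {..n}"
      using N(3) by (simp add: repeats_at_def lessThan_Suc_atMost)
    then obtain j where j: "j \<le> n" "b (n + 1) = b j" by blast
    have "f (int (n + 1)) = f (int j)" using j f[of n] f[of j] by simp
    from strip_period(1)[OF S(1) this, of 0] have "f (int (n + 1 - j)) = f 0"
      using j by (simp add: of_nat_diff)
    moreover have "j = 0"
    proof (rule ccontr)
      assume "j \<noteq> 0"
      then have "b (n + 1 - j) = b 0" using \<open>f (int (n + 1 - j)) = f 0\<close>
        f[of "n + 1 - j"] f[of 0] by simp
      moreover have "b 0 \<noteq> b (n + 1 - j)" using j(1) \<open>j \<noteq> 0\<close> by (intro inj_b) linarith+
      ultimately show False by simp
    qed
    ultimately show ?thesis by simp
  qed
  moreover have "b i = f (int i)" if "i \<le> n" for i using f[OF that] by simp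
  ultimately show ?thesis using S(1) by blast
qed

end

theorem corollary6p2:
  fixes M :: "'a matroid" and d :: 'a and b :: "nat \<Rightarrow> 'a" and n :: nat
  assumes "harmonic_matroid M"
    and "modular_sequence M d b (n + 1)"
  shows "moebius_harmonic_net M (d # map b [0..<n + 1])"
proof -
  interpret harmonic_matroid M by fact
  have set: "set (d # map b [0..<n + 1]) = insert d (b ` {..n})"
    by (simp add: atLeast0LessThan lessThan_Suc_atMost del: upt_Suc)
  obtain N where N: "conjugate_sequence M d b N" "enat (n + 1) < N"
    using assms(2) unfolding modular_sequence_def by blast
  have g: "insert d (b ` {..n}) \<subseteq> ground M"
  proof -
    have "enat k < N" if "k \<le> n" for k
      using le_less_trans[OF _ N(2), of "enat k"] that by simp
    then show ?thesis using N(1) by (auto simp: conjugate_sequence_def)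
  qed
  show ?thesis
  proof (cases "n = 0")
    case True
    \<comment> \<open>two points contain no three distinct ones, so no conjugate can be formed\<close>
    show ?thesis
    proof (rule moebius_net_of_closed[of _ d "b 0"])
      show "v \<in> set (d # map b [0..<n + 1])"
        if xyz: "{x, y, z} \<subseteq> set (d # map b [0..<n + 1])" "harm_conj M y z x v" for x y z v
      proof -
        obtain p q r s where "quad y x z p q r s" using xyz(2) unfolding harm_conj_iff by blast
        then have "distinct [y, x, z]" using quad_distinct by fastforce
        then show ?thesis using xyz(1) by (auto simp: True)
      qed
    qed (use g cl_extensive[of "{d, b 0}"] in \<open>auto simp: True\<close>)
  next
    case False
    then have "n > 0" by simp
    from modular_sequence_in_strip[OF assms(2) this]
    obtain f c s where S: "strip d f c s" and f: "\<And>i. i \<le> n \<Longrightarrow> b i = f (int i)"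
      and p: "f (int (n + 1)) = f 0" "inj_on (\<lambda>i. f (int i)) {..<n + 1}"
      by blast
    have "f i \<in> b ` {..n}" for i
    proof -
      have "i mod int (n + 1) < int (n + 1)" by (rule pos_mod_bound) simp
      then have le: "nat (i mod int (n + 1)) \<le> n" by linarith
      have "f i = f (i mod int (n + 1))"
        using strip_eq_iff_dvd[OF S _ p] by simp
      also have "\<dots> = f (int (nat (i mod int (n + 1))))" by simp
      also have "\<dots> = b (nat (i mod int (n + 1)))"
        using le by (rule f[symmetric])
      finally show ?thesis using le by simp
    qed
    then have range: "range f = b ` {..n}" using f by auto
    have "col d (f 0) x" if "x \<in> insert d (range f)" for x
      using that strip_line[OF S] g f by (auto simp: col_triv)
    then have cl: "insert d (range f) \<subseteq> cl M {d, f 0}"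
      using strip_step(3)[OF S] by (auto simp: col_def)
    show ?thesis
    proof (rule moebius_net_of_closed[of _ d "f 0"], unfold set range[symmetric])
      show "v \<in> insert d (range f)" if "{x, y, z} \<subseteq> insert d (range f)" "harm_conj M y z x v" for x y z v
        using strip_line_harm_closed[OF S _ p(1) p(2) that(2,1)] by simp
    qed (use g range cl in auto)
  qed
qed

end
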